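(* Let $G$ be a finite group. If $\eta(G)<2$, then every Sylow subgroup of $G$ is cyclic. In particular, $G$ is metacyclic.
   Context: For a finite group $G$, $\mathrm{cyc}(G)$ denotes the number of cyclic subgroups of $G$ (including the trivial one), $\pi(G)$ denotes the number of distinct prime divisors of $|G|$ (so $\pi(1)=0$), and $\eta(G)=\mathrm{cyc}(G)/2^{\pi(G)}$. A group is metacyclic if it has a cyclic normal subgroup with cyclic quotient. *)

theory Defs
  imports "HOL-Algebra.Algebra" "HOL-Computational_Algebra.Primes"
begin

definition cyc :: "('a, 'b) monoid_scheme \<Rightarrow> nat" where
  "cyc G = card {H. subgroup H G \<and> cyclic_group (G\<lparr>carrier := H\<rparr>)}"

definition num_prime_divisors :: "('a, 'b) monoid_scheme \<Rightarrow> nat" where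
  "num_prime_divisors G = card {p::nat. Factorial_Ring.prime p \<and> p dvd Coset.order G}"

definition cyc_eta :: "('a, 'b) monoid_scheme \<Rightarrow> real" where
  "cyc_eta G = real (cyc G) / 2 ^ num_prime_divisors G"

text \<open>
  For a prime \<open>p\<close> not dividing the group order, the only Sylow \<open>p\<close>-subgroup
  in this sense is the trivial one.
\<close>

definition sylow_subgroup :: "nat \<Rightarrow> 'a set \<Rightarrow> ('a, 'b) monoid_scheme \<Rightarrow> bool" where
  "sylow_subgroup p P G \<longleftrightarrow>
     Factorial_Ring.prime p \<and> subgroup P G \<and>
     card P = p ^ Factorial_Ring.multiplicity p (Coset.order G)"

definition metacyclic_group :: "('a, 'b) monoid_scheme \<Rightarrow> bool" where
  "metacyclic_group G \<longleftrightarrow>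
     (\<exists>N. N \<lhd> G \<and> cyclic_group (G\<lparr>carrier := N\<rparr>) \<and> cyclic_group (G Mod N))"

end

theory Submission
  imports Defs "HOL-Number_Theory.Totient"
begin

text \<open>
  Since a cyclic group of order \<open>d\<close> has \<open>\<phi>(d)\<close> generators, \<open>cyc(G)\<close> is the sum of \<open>1 / \<phi>(ord x)\<close> over
  all \<open>x\<close>. Frobenius' theorem gives at least \<open>m\<close> solutions of \<open>x ^ m = 1\<close> for every factor \<open>m\<close> of
  \<open>|G|\<close> coprime to its cofactor. Bounding \<open>1 / \<phi>(ord x)\<close> from below by a product of weights, one for
  each prime, and expanding that product turns these counts into a lower bound for \<open>cyc(G)\<close> that is
  a product of local factors. Each factor is at least \<open>2\<close>, and it is at least \<open>4\<close> at a prime \<open>p\<close> for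
  which \<open>G\<close> has no element of order \<open>|G|\<^sub>p\<close>. So \<open>\<eta>(G) < 2\<close> forces all Sylow subgroups to be cyclic.

  If all Sylow subgroups are cyclic, counting elements by the order of their \<open>p\<close>-part
  shows that \<open>x ^ m = 1\<close> has exactly \<open>m\<close> solutions when the primes dividing \<open>m\<close> exceed those dividing
  \<open>|G| / m\<close>. These solutions form a normal subgroup, hence \<open>G' \<noteq> G\<close>. By induction \<open>G''\<close> is cyclic, so it
  is centralized by \<open>G'\<close>; as \<open>G' / G''\<close> is cyclic too, \<open>G'\<close> is abelian and therefore cyclic, and so is
  \<open>G / G'\<close>.
\<close>

section \<open>Frobenius' theorem for coprime factors of the group order\<close>

locale finite_group = group +
  assumes finite_carrier [simp]: "finite (carrier G)"

lemma not_coprime_common_prime_nat: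
  fixes a b :: nat
  assumes "\<not> coprime a b"
  obtains p where "Factorial_Ring.prime p" "p dvd a" "p dvd b"
proof -
  have "gcd a b \<noteq> 1" using assms by (simp only: coprime_iff_gcd_eq_1 not_False_eq_True)
  then obtain p where "Factorial_Ring.prime p" "p dvd gcd a b" using prime_factor_nat by blast
  then show thesis using that by simp
qed

definition centralizer :: "('a, 'b) monoid_scheme \<Rightarrow> 'a \<Rightarrow> 'a set" where
  "centralizer G y = {g \<in> carrier G. g \<otimes>\<^bsub>G\<^esub> y = y \<otimes>\<^bsub>G\<^esub> g}"


lemma finite_group_subgroup:
  assumes "finite_group G" "subgroup H G"
  shows "finite_group (G\<lparr>carrier := H\<rparr>)"
  using assms subgroup.subset[of H G]
  by (auto simp: finite_group_def finite_group_axioms_def group.subgroup_imp_group intro: finite_subset)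

section \<open>Centralizers and conjugation\<close>

context group
begin

lemma centralizer_subgroup:
  assumes "y \<in> carrier G"
  shows "subgroup (centralizer G y) G"
proof
  show "centralizer G y \<subseteq> carrier G" "\<one> \<in> centralizer G y"
    using assms by (auto simp: centralizer_def)
next
  fix a b assume "a \<in> centralizer G y" "b \<in> centralizer G y"
  then show "a \<otimes> b \<in> centralizer G y"
    using assms by (simp add: centralizer_def) (metis m_assoc)
next
  fix a assume "a \<in> centralizer G y"
  then show "inv a \<in> centralizer G y"
    using assms by (simp add: centralizer_def)
      (metis inv_closed inv_solve_left inv_solve_right m_assoc m_closed)
qed

lemma conj_pow:
  assumes "g \<in> carrier G" "x \<in> carrier G"
  shows "(g \<otimes> x \<otimes> inv g) [^] (n::nat) = g \<otimes> (x [^] n) \<otimes> inv g"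
proof (induction n)
  case (Suc n)
  have "(g \<otimes> x [^] n \<otimes> inv g) \<otimes> (g \<otimes> x \<otimes> inv g) = g \<otimes> x [^] n \<otimes> (inv g \<otimes> g) \<otimes> x \<otimes> inv g"
    using assms by (simp only: m_assoc m_closed inv_closed nat_pow_closed)
  then show ?case using assms Suc by (simp add: m_assoc)
qed (use assms in simp)

lemma inv_conj:
  assumes "g \<in> carrier G" "x \<in> carrier G"
  shows "inv g \<otimes> (g \<otimes> x \<otimes> inv g) \<otimes> g = x" "g \<otimes> (inv g \<otimes> x \<otimes> g) \<otimes> inv g = x"
proof -
  have "inv g \<otimes> (g \<otimes> x \<otimes> inv g) \<otimes> g = (inv g \<otimes> g) \<otimes> x \<otimes> (inv g \<otimes> g)"
       "g \<otimes> (inv g \<otimes> x \<otimes> g) \<otimes> inv g = (g \<otimes> inv g) \<otimes> x \<otimes> (g \<otimes> inv g)"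
    using assms by (simp_all only: m_assoc m_closed inv_closed)
  then show "inv g \<otimes> (g \<otimes> x \<otimes> inv g) \<otimes> g = x" "g \<otimes> (inv g \<otimes> x \<otimes> g) \<otimes> inv g = x"
    using assms by simp_all
qed

lemma conj_pow_eq_one_iff:
  assumes "g \<in> carrier G" "x \<in> carrier G"
  shows "(g \<otimes> x \<otimes> inv g) [^] (n::nat) = \<one> \<longleftrightarrow> x [^] n = \<one>"
  using assms inv_conj(1)[of g "x [^] n"] by (auto simp: conj_pow)

lemma conj_mult:
  assumes "g \<in> carrier G" "x \<in> carrier G" "y \<in> carrier G"
  shows "(g \<otimes> x \<otimes> inv g) \<otimes> (g \<otimes> y \<otimes> inv g) = g \<otimes> (x \<otimes> y) \<otimes> inv g"
proof -
  have "(g \<otimes> x \<otimes> inv g) \<otimes> (g \<otimes> y \<otimes> inv g) = g \<otimes> x \<otimes> (inv g \<otimes> g) \<otimes> y \<otimes> inv g"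
    using assms by (simp only: m_assoc m_closed inv_closed)
  then show ?thesis using assms by (simp add: m_assoc)
qed

end

context finite_group
begin

text \<open>For \<open>y\<close> of order coprime to \<open>m\<close>, this counts the products of
  \<open>y\<close> with a commuting element of order dividing \<open>m\<close>.\<close>

definition roots_in_centralizer :: "nat \<Rightarrow> 'a \<Rightarrow> nat" where
  "roots_in_centralizer m y = card {z \<in> centralizer G y. z [^] m = \<one>}"

lemma roots_in_centralizer_conj:
  assumes "g \<in> carrier G" "y \<in> carrier G"
  shows "roots_in_centralizer m (g \<otimes> y \<otimes> inv g) = roots_in_centralizer m y"
proof -
  let ?A = "\<lambda>y. {z \<in> centralizer G y. z [^] m = \<one>}"
  have sub: "g \<otimes> z \<otimes> inv g \<in> ?A (g \<otimes> y \<otimes> inv g)" if "z \<in> ?A y" "g \<in> carrier G" "y \<in> carrier G" for z g y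
    using that by (auto simp: centralizer_def conj_mult conj_pow)
  have "bij_betw (\<lambda>z. g \<otimes> z \<otimes> inv g) (?A y) (?A (g \<otimes> y \<otimes> inv g))"
  proof (rule bij_betw_byWitness[where f' = "\<lambda>z. inv g \<otimes> z \<otimes> g"])
    show "(\<lambda>z. g \<otimes> z \<otimes> inv g) ` ?A y \<subseteq> ?A (g \<otimes> y \<otimes> inv g)"
      using sub assms by blast
    show "(\<lambda>z. inv g \<otimes> z \<otimes> g) ` ?A (g \<otimes> y \<otimes> inv g) \<subseteq> ?A y"
      using sub[of _ "g \<otimes> y \<otimes> inv g" "inv g"] assms by (auto simp: inv_conj)
  qed (use assms in \<open>auto simp: centralizer_def inv_conj\<close>)
  then show ?thesis
    by (simp add: roots_in_centralizer_def bij_betw_same_card)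
qed

definition conj_class :: "'a \<Rightarrow> 'a set" where
  "conj_class y = (\<lambda>g. g \<otimes> y \<otimes> inv g) ` carrier G"

lemma card_conj_class:
  assumes "y \<in> carrier G"
  shows "card (conj_class y) * card (centralizer G y) = order G"
proof -
  interpret C: group_action G "carrier G" "\<lambda>g. \<lambda>h \<in> carrier G. g \<otimes> h \<otimes> inv g"
    by (rule action_by_conjugation)
  have "orbit G (\<lambda>g. \<lambda>h \<in> carrier G. g \<otimes> h \<otimes> inv g) y = conj_class y"
    using assms by (auto simp: orbit_def conj_class_def)
  moreover have "stabilizer G (\<lambda>g. \<lambda>h \<in> carrier G. g \<otimes> h \<otimes> inv g) y = centralizer G y"
    using assms by (auto simp: stabilizer_def centralizer_def inv_solve_right')
  ultimately show ?thesis
    using C.orbit_stabilizer_theorem[OF assms] by simp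
qed

lemma conj_class_eq_iff:
  assumes "x \<in> carrier G" "y \<in> carrier G"
  shows "conj_class x = conj_class y \<longleftrightarrow> x \<in> conj_class y"
proof
  assume "conj_class x = conj_class y"
  moreover have "x \<in> conj_class x"
    unfolding conj_class_def using assms by (intro image_eqI[of _ _ \<one>]) auto
  ultimately show "x \<in> conj_class y" by simp
next
  have *: "conj_class (g \<otimes> y \<otimes> inv g) \<subseteq> conj_class y" if "y \<in> carrier G" "g \<in> carrier G" for g y
  proof
    fix z assume "z \<in> conj_class (g \<otimes> y \<otimes> inv g)"
    then obtain h where h: "h \<in> carrier G" "z = h \<otimes> (g \<otimes> y \<otimes> inv g) \<otimes> inv h"
      by (auto simp: conj_class_def)
    then have "z = (h \<otimes> g) \<otimes> y \<otimes> inv (h \<otimes> g)"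
      using that by (simp add: inv_mult_group m_assoc)
    then show "z \<in> conj_class y" using h that by (auto simp: conj_class_def)
  qed
  assume "x \<in> conj_class y"
  then obtain g where g: "g \<in> carrier G" "x = g \<otimes> y \<otimes> inv g"
    by (auto simp: conj_class_def)
  then have "y = inv g \<otimes> x \<otimes> inv (inv g)" using assms by (simp add: inv_conj)
  then show "conj_class x = conj_class y"
    using *[of y g] *[of x "inv g"] g assms by auto
qed

text \<open>The sum splits over conjugacy classes, and a class contributes its size times the common
  value, so divisibility can be checked class by class.\<close>

lemma dvd_sum_class_function:
  fixes f :: "'a \<Rightarrow> nat"
  assumes Y: "Y \<subseteq> carrier G" "\<And>y g. y \<in> Y \<Longrightarrow> g \<in> carrier G \<Longrightarrow> g \<otimes> y \<otimes> inv g \<in> Y"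
    and f: "\<And>y g. y \<in> Y \<Longrightarrow> g \<in> carrier G \<Longrightarrow> f (g \<otimes> y \<otimes> inv g) = f y"
    and dvd: "\<And>y. y \<in> Y \<Longrightarrow> m dvd card (conj_class y) * f y"
  shows "m dvd sum f Y"
proof -
  have "finite Y" using Y(1) by (rule finite_subset) simp
  then have "sum f Y = (\<Sum>C\<in>conj_class ` Y. sum f {x \<in> Y. conj_class x = C})"
    by (rule sum.image_gen)
  also have "m dvd \<dots>"
  proof (rule dvd_sum, clarsimp)
    fix y assume y: "y \<in> Y"
    have "conj_class y \<subseteq> Y" using Y(2)[OF y] by (auto simp: conj_class_def)
    then have "{x \<in> Y. conj_class x = conj_class y} = conj_class y"
      using conj_class_eq_iff[of _ y] Y(1) y by blast
    moreover have "sum f (conj_class y) = (\<Sum>_\<in>conj_class y. f y)"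
      by (intro sum.cong) (auto simp: conj_class_def f[OF y])
    ultimately show "m dvd sum f {x \<in> Y. conj_class x = conj_class y}"
      using dvd[OF y] by simp
  qed
  finally show ?thesis .
qed

text \<open>A solution of \<open>x ^ (u * v) = 1\<close> is uniquely a product of commuting elements
  \<open>y\<close> and \<open>z\<close> with \<open>y ^ v = 1\<close> and \<open>z ^ u = 1\<close>,
  both being powers of \<open>x\<close>.\<close>

lemma card_roots_coprime_mult:
  assumes "coprime u v"
  shows "card {x \<in> carrier G. x [^] (u * v) = \<one>}
    = (\<Sum>y | y \<in> carrier G \<and> y [^] v = \<one>. roots_in_centralizer u y)"
proof -
  \<comment> \<open>\<open>x [^] i\<close> extracts the part of \<open>x\<close> of order dividing
    \<open>v\<close>, and \<open>x [^] j\<close> the part of order dividing \<open>u\<close>. They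
    multiply to \<open>x\<close> because \<open>i + j\<close> is congruent to 1 modulo
    \<open>u * v\<close>.\<close>
  obtain i where i: "[i = 1] (mod v)" "[i = 0] (mod u)"
    using binary_chinese_remainder_nat[of v u 1 0] assms by (auto simp: coprime_commute)
  obtain j where j: "[j = 0] (mod v)" "[j = 1] (mod u)"
    using binary_chinese_remainder_nat[of v u 0 1] assms by (auto simp: coprime_commute)
  have pow_cong: "x [^] a = x [^] b" if "x \<in> carrier G" "x [^] n = \<one>" "[a = b] (mod n)" for x and a b n :: nat
  proof -
    have "int (ord x) dvd int n" using that by (simp add: pow_eq_id)
    then have "int (ord x) dvd int b - int a"
      using that(3) by (metis cong_iff_dvd_diff cong_int_iff cong_sym dvd_trans)
    then show ?thesis
      using int_pow_eq[of x "int a" "int b"] that by (simp add: int_pow_int)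
  qed
  let ?S = "SIGMA y : {y \<in> carrier G. y [^] v = \<one>}. {z \<in> centralizer G y. z [^] u = \<one>}"
  have "bij_betw (\<lambda>(y, z). y \<otimes> z) ?S {x \<in> carrier G. x [^] (u * v) = \<one>}"
  proof (rule bij_betw_byWitness[where f' = "\<lambda>x. (x [^] i, x [^] j)"])
    show "\<forall>a\<in>?S. (\<lambda>x. (x [^] i, x [^] j)) ((\<lambda>(y, z). y \<otimes> z) a) = a"
    proof (clarsimp simp: centralizer_def)
      fix y z assume yz: "y \<in> carrier G" "y [^] v = \<one>" "z [^] u = \<one>" "z \<in> carrier G" "z \<otimes> y = y \<otimes> z"
      then show "(y \<otimes> z) [^] i = y \<and> (y \<otimes> z) [^] j = z"
        using pow_cong[OF _ _ i(1), of y] pow_cong[OF _ _ i(2), of z]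
          pow_cong[OF _ _ j(1), of y] pow_cong[OF _ _ j(2), of z]
        by (simp add: pow_mult_distrib)
    qed
    have "[i + j = 1] (mod u * v)"
      using assms cong_add[OF i(1) j(1)] cong_add[OF i(2) j(2)]
      by (simp add: coprime_cong_mult_nat)
    then show "\<forall>x\<in>{x \<in> carrier G. x [^] (u * v) = \<one>}. (\<lambda>(y, z). y \<otimes> z) (x [^] i, x [^] j) = x"
      using pow_cong[of _ "u * v" "i + j" 1] by (auto simp: nat_pow_mult)
    show "(\<lambda>(y, z). y \<otimes> z) ` ?S \<subseteq> {x \<in> carrier G. x [^] (u * v) = \<one>}"
    proof (clarsimp simp: centralizer_def)
      fix y z assume yz: "y \<in> carrier G" "y [^] v = \<one>" "z [^] u = \<one>" "z \<in> carrier G" "z \<otimes> y = y \<otimes> z"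
      then have "y [^] (u * v) = \<one>" "z [^] (u * v) = \<one>"
        by (simp_all add: pow_eq_id)
      then show "(y \<otimes> z) [^] (u * v) = \<one>" using yz by (simp add: pow_mult_distrib)
    qed
    show "(\<lambda>x. (x [^] i, x [^] j)) ` {x \<in> carrier G. x [^] (u * v) = \<one>} \<subseteq> ?S"
    proof (intro image_subsetI)
      fix x assume "x \<in> {x \<in> carrier G. x [^] (u * v) = \<one>}"
      then have x: "x \<in> carrier G" "ord x dvd u * v" by (auto simp: pow_eq_id)
      have "u dvd i" "v dvd j" using i j by (auto simp: cong_0_iff)
      then have "u * v dvd i * v" "u * v dvd j * u" by (auto simp: mult.commute)
      then have "(x [^] i) [^] v = \<one>" "(x [^] j) [^] u = \<one>"
        using x dvd_trans[OF x(2)] by (simp_all add: nat_pow_pow pow_eq_id)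
      then show "(x [^] i, x [^] j) \<in> ?S"
        using x by (simp add: centralizer_def nat_pow_mult add.commute)
    qed
  qed
  then have "card {x \<in> carrier G. x [^] (u * v) = \<one>} = card ?S"
    by (simp add: bij_betw_same_card)
  also have "\<dots> = (\<Sum>y | y \<in> carrier G \<and> y [^] v = \<one>. roots_in_centralizer u y)"
    unfolding roots_in_centralizer_def
    by (subst card_SigmaI) (auto simp: centralizer_def)
  finally show ?thesis .
qed

end

section \<open>Divisibility of the number of roots\<close>

lemma (in finite_group) cauchy:
  assumes "Factorial_Ring.prime (p::nat)" "p dvd order G"
  obtains x where "x \<in> carrier G" "ord x = p"
proof -
  obtain m where "order G = p ^ 1 * m" using assms by auto
  then obtain H where H: "subgroup H G" "card H = p ^ 1"
    using sylow_thm[OF assms(1) is_group _ finite_carrier] by blast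
  have "1 < card H" using H assms prime_gt_1_nat by simp
  then have "\<not> H \<subseteq> {\<one>}"
    using card_mono[of "{\<one>}" H] by auto
  then obtain x where x: "x \<in> H" "x \<noteq> \<one>" by blast
  have xG: "x \<in> carrier G" by (rule subgroup.mem_carrier[OF H(1) x(1)])
  have "x [^] p = \<one>"
    using group.pow_order_eq_1[OF subgroup_imp_group[OF H(1)], of x] x H
    by (simp add: order_def flip: nat_pow_consistent)
  then have "ord x = p"
    using assms xG x(2) by (metis ord_eq_1 pow_eq_id prime_nat_iff)
  then show thesis using xG that by blast
qed

text \<open>The centralizer has order \<open>b * c\<close> with \<open>b\<close> dividing
  \<open>m\<close> and \<open>c\<close> dividing \<open>k\<close>. In it, \<open>z ^ m = 1\<close>
  and \<open>z ^ b = 1\<close> have the same solutions, and \<open>m\<close> divides the class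
  length times \<open>b\<close> because \<open>c\<close> is coprime to \<open>m\<close>. Frobenius'
  theorem for the centralizer is a hypothesis so that the lemma can serve inside the induction
  proving that theorem.\<close>

lemma (in finite_group) dvd_class_roots_if_frobenius:
  assumes "y \<in> carrier G" "order G = m * k" "coprime m k"
    and "\<And>b c. card (centralizer G y) = b * c \<Longrightarrow> coprime b c \<Longrightarrow>
      b dvd card {x \<in> centralizer G y. x [^] b = \<one>}"
  shows "m dvd card (conj_class y) * roots_in_centralizer m y"
proof -
  let ?C = "centralizer G y"
  have C: "subgroup ?C G" using assms by (simp add: centralizer_subgroup)
  have idx: "m * k = card (conj_class y) * card ?C" using card_conj_class assms by simp
  obtain b c where bc: "card ?C = b * c" "b dvd m" "c dvd k"
    using division_decomp[of "card ?C" m k] idx by auto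
  have "coprime m c" "coprime b c"
    using coprime_divisors[OF _ bc(3) assms(3)] bc(2) by auto
  have "{z \<in> ?C. z [^] m = \<one>} = {z \<in> ?C. z [^] b = \<one>}"
  proof (rule Collect_cong, rule conj_cong[OF refl])
    fix z assume z: "z \<in> ?C"
    then have zG: "z \<in> carrier G" by (simp add: centralizer_def)
    have "z [^] (b * c) = \<one>"
      using group.pow_order_eq_1[OF subgroup_imp_group[OF C], of z] z bc
      by (simp add: order_def flip: nat_pow_consistent)
    then have "ord z dvd c * b" using zG by (simp add: pow_eq_id mult.commute)
    then have "ord z dvd b" if "ord z dvd m"
      using that coprime_divisors[OF that dvd_refl \<open>coprime m c\<close>]
      by (simp add: coprime_dvd_mult_right_iff)
    then show "z [^] m = \<one> \<longleftrightarrow> z [^] b = \<one>"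
      using zG bc(2) by (auto simp: pow_eq_id)
  qed
  then have "b dvd roots_in_centralizer m y"
    using assms(4)[OF bc(1) \<open>coprime b c\<close>] by (simp add: roots_in_centralizer_def)
  moreover have "m dvd card (conj_class y) * b"
    using dvd_triv_left[of m k] \<open>coprime m c\<close>
    by (simp add: idx bc(1) coprime_dvd_mult_left_iff flip: mult.assoc)
  ultimately show ?thesis by (meson dvd_trans mult_dvd_mono dvd_refl)
qed

text \<open>
  For a prime power \<open>q\<close> exactly dividing \<open>k\<close>, split the solutions of \<open>x ^ (m * q) = 1\<close> by their part
  \<open>y\<close> of order dividing \<open>q\<close>. Modulo \<open>m\<close>, only the central \<open>y\<close> contribute. They form a group \<open>A\<close> of order
  coprime to \<open>m\<close>, and each of them contributes the number of solutions of \<open>x ^ m = 1\<close>.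
\<close>

lemma (in finite_group) frobenius_step:
  assumes "order G = m * k" "coprime m k"
    and noncentral: "\<And>m k y. y \<in> carrier G \<Longrightarrow> centralizer G y \<noteq> carrier G \<Longrightarrow> order G = m * k \<Longrightarrow>
      coprime m k \<Longrightarrow> m dvd card (conj_class y) * roots_in_centralizer m y"
  shows "m dvd card {x \<in> carrier G. x [^] m = \<one>}"
  using assms(1,2)
proof (induction k arbitrary: m rule: less_induct)
  case (less k)
  show ?case
  proof (cases "k = 1")
    case True
    then have "{x \<in> carrier G. x [^] m = \<one>} = carrier G"
      using less.prems(1) pow_order_eq_1 by auto
    then show ?thesis using less.prems True by (simp add: order_def)
  next
    case False
    then obtain p where p: "Factorial_Ring.prime p" "p dvd k" using prime_factor_nat by blast
    have "k > 0" using less.prems(1) order_gt_0_iff_finite by (cases k) auto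
    then obtain a k' where k: "k = p ^ a * k'" "\<not> p dvd k'" "a > 0"
      using multiplicity_decompose'[of k p] p by (metis multiplicity_gt_zero_iff neq0_conv not_prime_unit)
    then have "k' < k" using p \<open>k > 0\<close> one_less_power[OF prime_gt_1_nat[OF p(1)] k(3)] by simp
    let ?q = "p ^ a"
    have mq: "coprime m ?q" and "coprime m k'" using less.prems(2) k(1) by auto
    \<comment> \<open>The primary part \<open>?q\<close> moves from the cofactor to
      \<open>m\<close>, so the induction hypothesis counts the solutions of
      \<open>x ^ (m * ?q) = 1\<close>.\<close>
    have "coprime (m * ?q) k'"
      using \<open>coprime m k'\<close> p(1) k(2) by (simp add: prime_imp_coprime)
    then have "m * ?q dvd card {x \<in> carrier G. x [^] (m * ?q) = \<one>}"
      using less.IH[OF \<open>k' < k\<close>, of "m * ?q"] less.prems(1) k(1) by (simp add: mult.assoc)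
    then have dvd: "m dvd (\<Sum>y | y \<in> carrier G \<and> y [^] ?q = \<one>. roots_in_centralizer m y)"
      unfolding card_roots_coprime_mult[OF mq] by (rule dvd_mult_left)
    let ?Y = "{y \<in> carrier G. y [^] ?q = \<one>}"
    let ?A = "{y \<in> ?Y. centralizer G y = carrier G}"
    have A_iff: "y \<in> ?A \<longleftrightarrow> y \<in> carrier G \<and> y [^] ?q = \<one> \<and> (\<forall>g\<in>carrier G. g \<otimes> y = y \<otimes> g)" for y
      by (auto simp: centralizer_def)
    have "m dvd (\<Sum>y \<in> ?Y - ?A. roots_in_centralizer m y)"
    proof (rule dvd_sum_class_function)
      fix y g assume yg: "y \<in> ?Y - ?A" "g \<in> carrier G"
      show "g \<otimes> y \<otimes> inv g \<in> ?Y - ?A"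
      proof -
        define z where "z = g \<otimes> y \<otimes> inv g"
        have "z \<notin> ?A"
        proof
          assume z: "z \<in> ?A"
          have "y = inv g \<otimes> (z \<otimes> g)"
            using yg inv_conj(1)[of g y] by (simp add: z_def m_assoc)
          also have "z \<otimes> g = g \<otimes> z" using z yg unfolding A_iff by auto
          also have "inv g \<otimes> (g \<otimes> z) = z" using yg z by (simp flip: m_assoc)
          finally show False using z yg by simp
        qed
        then show ?thesis using yg by (simp add: conj_pow_eq_one_iff z_def)
      qed
      show "roots_in_centralizer m (g \<otimes> y \<otimes> inv g) = roots_in_centralizer m y"
        using yg by (simp add: roots_in_centralizer_conj)
    qed (use noncentral[OF _ _ less.prems] in auto)
    moreover have "(\<Sum>y \<in> ?Y. roots_in_centralizer m y)
        = (\<Sum>y \<in> ?Y - ?A. roots_in_centralizer m y) + (\<Sum>y \<in> ?A. roots_in_centralizer m y)"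
      by (rule sum.subset_diff) auto
    ultimately have "m dvd (\<Sum>y \<in> ?A. roots_in_centralizer m y)"
      using dvd by (simp add: dvd_add_right_iff)
    also have "(\<Sum>y \<in> ?A. roots_in_centralizer m y) = card ?A * card {x \<in> carrier G. x [^] m = \<one>}"
      by (simp add: roots_in_centralizer_def)
    finally have A_dvd: "m dvd card ?A * card {x \<in> carrier G. x [^] m = \<one>}" .
    have comm: "g \<otimes> w = w \<otimes> g" if "w \<in> ?A" "g \<in> carrier G" for w g
      using that unfolding A_iff by blast
    have A: "subgroup ?A G"
    proof
      show "?A \<subseteq> carrier G" "\<one> \<in> ?A" by (auto simp: centralizer_def)
      fix x assume x: "x \<in> ?A"
      then have x': "x \<in> carrier G" "x [^] ?q = \<one>" by auto
      have "g \<otimes> inv x = inv x \<otimes> g" if "g \<in> carrier G" for g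
        using arg_cong[OF comm[OF x, of "inv g"], of "m_inv G"] that x' by (simp add: inv_mult_group)
      then show "inv x \<in> ?A"
        using x' unfolding A_iff by (simp add: nat_pow_inv)
      fix y assume y: "y \<in> ?A"
      then have y': "y \<in> carrier G" "y [^] ?q = \<one>" by auto
      have "g \<otimes> (x \<otimes> y) = (x \<otimes> y) \<otimes> g" if g: "g \<in> carrier G" for g
        using x' y' g comm[OF x g] comm[OF y g] m_assoc by metis
      then show "x \<otimes> y \<in> ?A"
        using x' y' comm[OF y x'(1)] unfolding A_iff by (simp add: pow_mult_distrib)
    qed
    \<comment> \<open>By Cauchy, a common prime would be the order of an element of
      \<open>?A\<close>, hence divide \<open>?q\<close>, which is coprime to
      \<open>m\<close>.\<close>
    have "coprime m (card ?A)"
    proof (rule ccontr)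
      assume "\<not> coprime m (card ?A)"
      then obtain r where r: "Factorial_Ring.prime r" "r dvd m" "r dvd card ?A"
        by (rule not_coprime_common_prime_nat)
      interpret A: finite_group "G\<lparr>carrier := ?A\<rparr>"
        by (rule finite_group_subgroup[OF finite_group_axioms A])
      obtain x where x: "x \<in> ?A" "A.ord x = r"
        using A.cauchy[OF r(1)] r(3) by (auto simp: order_def)
      then have "r dvd ?q"
        using A.pow_eq_id[of x ?q] by (simp flip: nat_pow_consistent)
      then show False using mq r(1,2) by (meson coprime_common_divisor not_prime_unit)
    qed
    then show ?thesis using A_dvd by (simp add: coprime_dvd_mult_right_iff)
  qed
qed

text \<open>By induction on the group order: the centralizer of a noncentral element is a smaller
  group, so the induction hypothesis provides what \<open>frobenius_step\<close> asks for noncentral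
  elements.\<close>

theorem frobenius_coprime_factor:
  assumes "finite_group G" "order G = m * k" "coprime m k"
  shows "m dvd card {x \<in> carrier G. x [^]\<^bsub>G\<^esub> m = \<one>\<^bsub>G\<^esub>}"
  using assms
proof (induction "order G" arbitrary: G m k rule: less_induct)
  case less
  then interpret finite_group G by simp
  show ?case
  proof (rule frobenius_step[OF less.prems(2,3)], rule dvd_class_roots_if_frobenius)
    fix m k y b c
    assume y: "y \<in> carrier G" "centralizer G y \<noteq> carrier G"
      and bc: "card (centralizer G y) = b * c" "coprime b c"
    have C: "subgroup (centralizer G y) G" using y by (simp add: centralizer_subgroup)
    have "centralizer G y \<subset> carrier G" using y subgroup.subset[OF C] by blast
    then have "card (centralizer G y) < order G" by (simp add: order_def psubset_card_mono)
    then show "b dvd card {x \<in> centralizer G y. x [^]\<^bsub>G\<^esub> b = \<one>\<^bsub>G\<^esub>}"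
      using less.hyps[of "G\<lparr>carrier := centralizer G y\<rparr>" b c] bc
        finite_group_subgroup[OF finite_group_axioms C]
      by (simp add: order_def flip: nat_pow_consistent)
  qed
qed

section \<open>Counting cyclic subgroups\<close>

lemma (in group) ord_subgroup:
  assumes "subgroup H G"
  shows "group.ord (G\<lparr>carrier := H\<rparr>) x = ord x"
  by (simp add: group.ord_def[OF subgroup_imp_group[OF assms]] ord_def flip: nat_pow_consistent)

lemma (in finite_group) cyclic_group_iff_ord:
  "cyclic_group G \<longleftrightarrow> (\<exists>x\<in>carrier G. ord x = order G)"
proof -
  have "subgroup_generated G {x} = G \<longleftrightarrow> ord x = order G" if x: "x \<in> carrier G" for x
  proof
    assume "subgroup_generated G {x} = G"
    then show "ord x = order G" using cyclic_order_is_ord[OF x] by simp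
  next
    assume "ord x = order G"
    then have "generate G {x} = carrier G"
      using generate_pow_card[OF x] generate_incl[of "{x}"] x
      by (intro card_subset_eq) (auto simp: order_def)
    then show "subgroup_generated G {x} = G"
      using x by (simp add: subgroup_generated_def)
  qed
  then show ?thesis unfolding cyclic_group_def by blast
qed

lemma (in finite_group) cyclic_subgroup_iff_ord:
  assumes "subgroup H G"
  shows "cyclic_group (G\<lparr>carrier := H\<rparr>) \<longleftrightarrow> (\<exists>x\<in>H. ord x = card H)"
  using finite_group.cyclic_group_iff_ord[OF finite_group_subgroup[OF finite_group_axioms assms]]
  by (simp add: ord_subgroup[OF assms] order_def)

text \<open>Asks for a single element whose order is the full \<open>p\<close>-part of the group
  order, a generator of some Sylow \<open>p\<close>-subgroup. For primes not dividing the order, the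
  identity qualifies.\<close>

definition cyclic_sylow :: "('a, 'b) monoid_scheme \<Rightarrow> bool" where
  "cyclic_sylow G \<longleftrightarrow> (\<forall>p. Factorial_Ring.prime p \<longrightarrow>
     (\<exists>x\<in>carrier G. group.ord G x = p ^ multiplicity p (order G)))"

section \<open>Generators of cyclic subgroups and a lower bound for \<open>cyc G\<close>\<close>

context finite_group
begin

lemma ord_pos: "x \<in> carrier G \<Longrightarrow> 0 < ord x"
  using ord_ge_1 by fastforce

lemma generate_singleton_closed: "x \<in> carrier G \<Longrightarrow> generate G {x} \<subseteq> carrier G"
  using generate_incl[of "{x}"] by simp

lemma generate_singleton_self: "x \<in> generate G {x}"
  by (simp add: generate.incl)

lemma generate_singleton_le:
  assumes "x \<in> carrier G" "y \<in> generate G {x}"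
  shows "generate G {y} \<subseteq> generate G {x}"
  using assms generate_subgroup_incl[of "{y}" "generate G {x}"] generate_is_subgroup[of "{x}"] by simp

lemma generate_singleton_eq:
  assumes "x \<in> carrier G" "y \<in> generate G {x}" "ord y = ord x"
  shows "generate G {y} = generate G {x}"
proof (rule card_subset_eq)
  show "finite (generate G {x})"
    by (rule finite_subset[OF generate_singleton_closed[OF assms(1)] finite_carrier])
  show "generate G {y} \<subseteq> generate G {x}" by (rule generate_singleton_le[OF assms(1,2)])
  have "y \<in> carrier G" using assms(2) generate_singleton_closed[OF assms(1)] by (rule rev_subsetD)
  then show "card (generate G {y}) = card (generate G {x})"
    using assms(1,3) by (simp flip: generate_pow_card)
qed

lemma card_generators:
  assumes x: "x \<in> carrier G"
  shows "card {y \<in> carrier G. generate G {y} = generate G {x}} = totient (ord x)"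
proof -
  have "{y \<in> carrier G. generate G {y} = generate G {x}} = (\<lambda>k. x [^] k) ` totatives (ord x)"
  proof (intro equalityI subsetI)
    fix y assume "y \<in> {y \<in> carrier G. generate G {y} = generate G {x}}"
    then have y: "y \<in> carrier G" "generate G {y} = generate G {x}" by auto
    then have ord: "ord y = ord x" using generate_pow_card x by metis
    have "y \<in> generate G {x}" using y generate_singleton_self by metis
    then obtain k :: nat where k: "y = x [^] k"
      using generate_pow_on_finite_carrier[OF finite_carrier x] by auto
    have cop: "coprime k (ord x)"
      using pow_ord_eq_ord_iff[OF finite_carrier x, of k] ord k by simp
    \<comment> \<open>\<open>totatives 1\<close> is \<open>{1}\<close> and does not contain 0, so
      the residue 0 is replaced by 1 when \<open>x\<close> is trivial.\<close>
    define l where "l = (if ord x = 1 then 1 else k mod ord x)"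
    have "l \<in> totatives (ord x)"
    proof (cases "ord x = 1")
      case False
      then have "0 < k mod ord x"
        using coprime_common_divisor[OF cop _ dvd_refl] False by (auto simp: mod_greater_zero_iff_not_dvd)
      then show ?thesis using cop ord_pos[OF x] False
        by (simp add: l_def in_totatives_iff less_imp_le)
    qed (simp add: l_def in_totatives_iff)
    moreover have "y = x [^] l"
    proof (cases "ord x = 1")
      case True
      then show ?thesis using k x ord_eq_1 by (simp add: l_def)
    next
      case False
      have "x [^] k = x [^] (ord x * (k div ord x)) \<otimes> x [^] (k mod ord x)"
        using x by (simp add: nat_pow_mult)
      also have "x [^] (ord x * (k div ord x)) = \<one>"
        using x by (simp add: pow_eq_id)
      finally show ?thesis using k False x by (simp add: l_def)
    qed
    ultimately show "y \<in> (\<lambda>k. x [^] k) ` totatives (ord x)" by blast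
  next
    fix y assume "y \<in> (\<lambda>k. x [^] k) ` totatives (ord x)"
    then obtain k where k: "y = x [^] k" "coprime k (ord x)" by (auto simp: in_totatives_iff)
    then have "ord y = ord x" using pow_ord_eq_ord_iff[OF finite_carrier x, of k] by simp
    moreover have "y \<in> generate G {x}"
      using k generate_pow_on_finite_carrier[OF finite_carrier x] by auto
    ultimately show "y \<in> {y \<in> carrier G. generate G {y} = generate G {x}}"
      using generate_singleton_eq x k by auto
  qed
  moreover have "inj_on (\<lambda>k. x [^] k) (totatives (ord x))"
    by (rule inj_on_subset[OF ord_inj'[OF x]]) (auto simp: in_totatives_iff)
  ultimately show ?thesis by (simp add: card_image totient_def)
qed

text \<open>The elements are grouped by the subgroup that they generate; the generators of one
  cyclic subgroup have total weight 1.\<close>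

lemma cyc_eq_sum: "real (cyc G) = (\<Sum>x\<in>carrier G. 1 / real (totient (ord x)))"
proof -
  let ?gen = "\<lambda>x. generate G {x}"
  have "{H. subgroup H G \<and> cyclic_group (G\<lparr>carrier := H\<rparr>)} = ?gen ` carrier G"
  proof (intro equalityI subsetI)
    fix H assume "H \<in> {H. subgroup H G \<and> cyclic_group (G\<lparr>carrier := H\<rparr>)}"
    then obtain x where H: "subgroup H G" and x: "x \<in> H" "ord x = card H"
      by (auto simp: cyclic_subgroup_iff_ord)
    have xG: "x \<in> carrier G" by (rule subgroup.mem_carrier[OF H x(1)])
    have "finite H" by (rule finite_subset[OF subgroup.subset[OF H] finite_carrier])
    then have "generate G {x} = H"
      using x generate_pow_card[OF xG] generate_subgroup_incl[of "{x}" H] H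
      by (intro card_subset_eq) auto
    then show "H \<in> ?gen ` carrier G" using xG by blast
  next
    fix H assume "H \<in> ?gen ` carrier G"
    then obtain x where x: "x \<in> carrier G" "H = generate G {x}" by blast
    then have "subgroup H G" using generate_is_subgroup[of "{x}"] by simp
    then show "H \<in> {H. subgroup H G \<and> cyclic_group (G\<lparr>carrier := H\<rparr>)}"
      using x generate_pow_card generate_singleton_self[of x] by (auto simp: cyclic_subgroup_iff_ord)
  qed
  then have "real (cyc G) = (\<Sum>H\<in>?gen ` carrier G. 1)" by (simp add: cyc_def)
  also have "\<dots> = (\<Sum>H\<in>?gen ` carrier G. \<Sum>x | x \<in> carrier G \<and> ?gen x = H. 1 / real (totient (ord x)))"
  proof (rule sum.cong[OF refl])
    fix H assume "H \<in> ?gen ` carrier G"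
    then obtain x where x: "x \<in> carrier G" "H = ?gen x" by blast
    have "(\<Sum>y | y \<in> carrier G \<and> ?gen y = H. 1 / real (totient (ord y)))
        = (\<Sum>y | y \<in> carrier G \<and> ?gen y = H. 1 / real (totient (ord x)))"
      using x by (intro sum.cong refl) (auto simp: generate_pow_card)
    also have "\<dots> = 1"
      using x ord_pos[OF x(1)] by (simp add: card_generators)
    finally show "1 = (\<Sum>y | y \<in> carrier G \<and> ?gen y = H. 1 / real (totient (ord y)))" by simp
  qed
  also have "\<dots> = (\<Sum>x\<in>carrier G. 1 / real (totient (ord x)))"
    by (rule sum.image_gen[symmetric]) simp
  finally show ?thesis .
qed

text \<open>
  With \<open>w q = 1 / \<phi>(q ^ e q)\<close>, the product of \<open>w q\<close> over the primes dividing \<open>ord x\<close> is a lower bound of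
  \<open>1 / \<phi>(ord x)\<close>. Writing it as a product over all primes of \<open>w q + (0 or 1 - w q)\<close> and expanding gives a
  nonnegative combination of the indicator functions of "\<open>ord x\<close> is divisible by primes in \<open>S\<close> only".
\<close>

lemma cyc_lower_bound:
  defines "P \<equiv> prime_factors (order G)"
  assumes e: "\<And>q. q \<in> P \<Longrightarrow> 0 < e q"
    and mult: "\<And>x q. x \<in> carrier G \<Longrightarrow> q \<in> P \<Longrightarrow> multiplicity q (ord x) \<le> e q"
  shows "(\<Prod>q\<in>P. 1 + (real q ^ multiplicity q (order G) - 1) / real (totient (q ^ e q))) \<le> real (cyc G)"
proof -
  let ?n = "order G" and ?a = "\<lambda>q. multiplicity q (order G)"
  define w where "w q = 1 / real (totient (q ^ e q))" for q
  have n: "0 < ?n" using order_gt_0_iff_finite by simp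
  have prime: "Factorial_Ring.prime q" if "q \<in> P" for q using that by (auto simp: P_def)
  have w: "0 < w q" "w q \<le> 1" if "q \<in> P" for q
  proof -
    have "1 \<le> totient (q ^ e q)" using prime_gt_0_nat[OF prime[OF that]] by (simp add: Suc_le_eq)
    then show "0 < w q" "w q \<le> 1" by (simp_all add: w_def divide_le_eq_1 Suc_le_eq)
  qed
  define N where "N S = (\<Prod>q\<in>S. q ^ ?a q)" for S
  \<comment> \<open>Thus \<open>w q + u x q\<close> is \<open>w q\<close> if \<open>q\<close>
    divides \<open>ord x\<close>, and 1 otherwise.\<close>
  define u where "u x q = (if q dvd ord x then 0 else 1 - w q)" for x q
  \<comment> \<open>Frobenius yields at least \<open>N S\<close> elements whose order involves only
    primes in \<open>S\<close>. On these, \<open>u x q\<close> is \<open>1 - w q\<close> for all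
    \<open>q\<close> outside \<open>S\<close>, and the terms of all other elements are
    nonnegative.\<close>
  have card: "real (N S) * (\<Prod>q\<in>P - S. 1 - w q) \<le> (\<Sum>x\<in>carrier G. \<Prod>q\<in>P - S. u x q)" if S: "S \<subseteq> P" for S
  proof -
    have finS: "finite S" using S finite_subset P_def by auto
    have fact: "?n = N S * N (P - S)"
      using S n prod.subset_diff[of S P "\<lambda>q. q ^ ?a q"]
      by (simp add: N_def P_def prime_factorization_nat mult.commute flip: prime_factorization_nat)
    have cop: "coprime (N S) (N (P - S))"
      unfolding N_def by (intro prod_coprime_left prod_coprime_right coprime_power_left_iff[THEN iffD2] disjI1 coprime_power_right_iff[THEN iffD2] primes_coprime) (use S prime in auto)
    let ?R = "{x \<in> carrier G. x [^] N S = \<one>}"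
    have "N S dvd card ?R"
      using frobenius_coprime_factor[OF finite_group_axioms fact cop] .
    moreover have "\<one> \<in> ?R" by simp
    then have "0 < card ?R" by (subst card_gt_0_iff) auto
    ultimately have "N S \<le> card ?R" by (simp add: dvd_imp_le)
    have pos: "0 \<le> 1 - w q" if "q \<in> P" for q using w that by simp
    have "real (N S) * (\<Prod>q\<in>P - S. 1 - w q) \<le> real (card ?R) * (\<Prod>q\<in>P - S. 1 - w q)"
      using \<open>N S \<le> card ?R\<close> pos by (intro mult_right_mono prod_nonneg) auto
    also have "\<dots> = (\<Sum>x\<in>?R. \<Prod>q\<in>P - S. 1 - w q)" by simp
    also have "\<dots> = (\<Sum>x\<in>?R. \<Prod>q\<in>P - S. u x q)"
    proof (intro sum.cong prod.cong refl)
      fix x q assume x: "x \<in> ?R" and q: "q \<in> P - S"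
      have "\<not> q dvd ord x"
      proof
        assume "q dvd ord x"
        then have "q dvd N S" using x by (auto simp: pow_eq_id intro: dvd_trans)
        moreover have "q dvd q ^ ?a q"
          using q n by (intro dvd_power disjI1) (auto simp: P_def prime_factors_multiplicity)
        then have "q dvd N (P - S)"
          unfolding N_def using q by (intro dvd_prodI[THEN dvd_trans[rotated]]) (auto simp: P_def)
        ultimately show False using cop prime q by (metis DiffD1 coprime_common_divisor not_prime_unit)
      qed
      then show "1 - w q = u x q" by (simp add: u_def)
    qed
    also have "\<dots> \<le> (\<Sum>x\<in>carrier G. \<Prod>q\<in>P - S. u x q)"
      using pos by (intro sum_mono2 prod_nonneg) (auto simp: u_def)
    finally show ?thesis .
  qed
  \<comment> \<open>The product of the local factors expands into a sum over the subsets
    \<open>S\<close>; after the termwise estimate, the same expansion is undone for each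
    \<open>x\<close> separately.\<close>
  have "(\<Prod>q\<in>P. 1 + (real q ^ ?a q - 1) / real (totient (q ^ e q))) = (\<Prod>q\<in>P. w q * real q ^ ?a q + (1 - w q))"
    by (intro prod.cong refl) (simp add: w_def diff_divide_distrib)
  also have "\<dots> = (\<Sum>S\<in>Pow P. (\<Prod>q\<in>S. w q) * (real (N S) * (\<Prod>q\<in>P - S. 1 - w q)))"
    by (subst prod_add) (simp_all add: P_def N_def prod.distrib mult.assoc)
  also have "\<dots> \<le> (\<Sum>S\<in>Pow P. (\<Prod>q\<in>S. w q) * (\<Sum>x\<in>carrier G. \<Prod>q\<in>P - S. u x q))"
    using w card by (intro sum_mono mult_left_mono prod_nonneg) (auto intro!: less_imp_le w(1))
  also have "\<dots> = (\<Sum>x\<in>carrier G. \<Sum>S\<in>Pow P. (\<Prod>q\<in>S. w q) * (\<Prod>q\<in>P - S. u x q))"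
    by (simp add: sum_distrib_left) (rule sum.swap)
  also have "\<dots> = (\<Sum>x\<in>carrier G. \<Prod>q\<in>P. w q + u x q)"
    by (simp add: prod_add P_def)
  also have "\<dots> \<le> (\<Sum>x\<in>carrier G. 1 / real (totient (ord x)))"
  proof (rule sum_mono)
    fix x assume x: "x \<in> carrier G"
    have T: "prime_factors (ord x) = {q \<in> P. q dvd ord x}"
      using ord_dvd_group_order[OF x] n ord_pos[OF x]
      by (auto simp: P_def prime_factors_dvd intro: dvd_trans)
    have "totient (ord x) = (\<Prod>q\<in>prime_factors (ord x). q ^ (multiplicity q (ord x) - 1) * (q - 1))"
      using ord_pos[OF x] by (rule totient_formula1)
    \<comment> \<open>The factor at \<open>q\<close> is the totient of a power of \<open>q\<close>
      with exponent between 1 and \<open>e q\<close>.\<close>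
    also have "\<dots> \<le> (\<Prod>q\<in>prime_factors (ord x). totient (q ^ e q))"
    proof (rule prod_mono)
      fix q assume "q \<in> prime_factors (ord x)"
      then have "q \<in> P" using T by blast
      then show "0 \<le> q ^ (multiplicity q (ord x) - 1) * (q - 1) \<and>
          q ^ (multiplicity q (ord x) - 1) * (q - 1) \<le> totient (q ^ e q)"
        using mult[OF x, of q] e[of q] prime[of q] prime_gt_0_nat[of q]
        by (auto simp: totient_prime_power intro!: power_increasing mult_right_mono)
    qed
    finally have "real (totient (ord x)) \<le> (\<Prod>q\<in>prime_factors (ord x). real (totient (q ^ e q)))"
      by (metis of_nat_le_iff of_nat_prod)
    then have "1 / (\<Prod>q\<in>prime_factors (ord x). real (totient (q ^ e q))) \<le> 1 / real (totient (ord x))"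
      using ord_pos[OF x] prime_gt_0_nat
      by (intro divide_left_mono mult_pos_pos prod_pos) (auto simp: in_prime_factors_iff)
    moreover have "1 / (\<Prod>q\<in>prime_factors (ord x). real (totient (q ^ e q))) = (\<Prod>q\<in>P. w q + u x q)"
    proof -
      have "1 / (\<Prod>q\<in>prime_factors (ord x). real (totient (q ^ e q))) = (\<Prod>q | q \<in> P \<and> q dvd ord x. w q)"
        by (simp add: w_def T prod_dividef)
      also have "\<dots> = (\<Prod>q\<in>P. if q dvd ord x then w q else 1)"
        by (rule prod.inter_filter) (simp add: P_def)
      also have "\<dots> = (\<Prod>q\<in>P. w q + u x q)"
        by (intro prod.cong) (auto simp: u_def)
      finally show ?thesis .
    qed
    ultimately show "(\<Prod>q\<in>P. w q + u x q) \<le> 1 / real (totient (ord x))" by simp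
  qed
  finally show ?thesis by (simp add: cyc_eq_sum)
qed

section \<open>Cyclic Sylow subgroups from the bound on \<open>cyc_eta G\<close>\<close>

lemma ord_power_of_dvd:
  assumes "x \<in> carrier G" "d dvd ord x"
  obtains y where "y \<in> carrier G" "ord y = d" "y \<in> generate G {x}"
proof
  let ?k = "ord x div d"
  have "?k dvd ord x" using assms(2) by auto
  then show "ord (x [^] ?k) = d"
    using ord_pow[OF assms(1), of ?k] ord_pos[OF assms(1)] assms(2) by auto
  show "x [^] ?k \<in> carrier G" using assms by simp
  show "x [^] ?k \<in> generate G {x}"
    using generate_pow_on_finite_carrier[OF finite_carrier assms(1)] by blast
qed

text \<open>If no element has the full \<open>p\<close>-part as its order, element orders have a
  \<open>p\<close>-exponent smaller than that of the group order. Lowering \<open>e p\<close> by one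
  accordingly raises the local factor at \<open>p\<close> to at least 4, and
  \<open>cyc_eta G\<close> to at least 2.\<close>

lemma cyclic_sylow_if_cyc_eta:
  assumes "cyc_eta G < 2"
  shows "cyclic_sylow G"
proof (rule ccontr)
  assume "\<not> cyclic_sylow G"
  then obtain p where p: "Factorial_Ring.prime p"
    and no: "\<And>x. x \<in> carrier G \<Longrightarrow> ord x \<noteq> p ^ multiplicity p (order G)"
    by (auto simp: cyclic_sylow_def)
  let ?a = "\<lambda>q. multiplicity q (order G)"
  let ?P = "prime_factors (order G)"
  have n: "0 < order G" using order_gt_0_iff_finite by simp
  have "?a p \<noteq> 0" using no[of \<one>] by (intro notI) simp
  then have pP: "p \<in> ?P" using p n by (simp add: prime_factors_multiplicity)
  \<comment> \<open>By Cauchy. So the exponent is at least 2, and \<open>e p = Suc b\<close> is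
    positive, as \<open>cyc_lower_bound\<close> requires.\<close>
  moreover have "?a p \<noteq> 1"
    using cauchy[OF p] no pP by (metis in_prime_factors_iff power_one_right)
  ultimately obtain b where b: "?a p = Suc (Suc b)" using \<open>?a p \<noteq> 0\<close>
    by (metis One_nat_def not0_implies_Suc)
  define e where "e q = (if q = p then Suc b else ?a q)" for q
  let ?F = "\<lambda>q. 1 + (real q ^ ?a q - 1) / real (totient (q ^ e q))"
  have le: "(\<Prod>q\<in>?P. ?F q) \<le> real (cyc G)"
  proof (rule cyc_lower_bound)
    show "0 < e q" if "q \<in> ?P" for q
      using that n by (auto simp: e_def prime_factors_multiplicity)
    show "multiplicity q (ord x) \<le> e q" if x: "x \<in> carrier G" and q: "q \<in> ?P" for x q
    proof (rule ccontr)
      assume "\<not> multiplicity q (ord x) \<le> e q"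
      moreover have "multiplicity q (ord x) \<le> ?a q"
        using ord_dvd_group_order[OF x] n dvd_imp_multiplicity_le by auto
      ultimately have "q = p" "multiplicity p (ord x) = ?a p"
        using b by (auto simp: e_def split: if_splits)
      then have "p ^ ?a p dvd ord x" by (metis multiplicity_dvd)
      then show False using ord_power_of_dvd[OF x] no by metis
    qed
  qed
  have two: "2 \<le> ?F q" if q: "q \<in> ?P - {p}" for q
  proof -
    have "1 < q ^ ?a q"
      using q n prime_gt_1_nat[of q] by (intro one_less_power) (auto simp: prime_factors_multiplicity)
    then have "totient (q ^ ?a q) < q ^ ?a q" "0 < totient (q ^ ?a q)"
      by (rule totient_less, simp only: totient_gt_0_iff)
    then have "real (totient (q ^ ?a q)) \<le> real q ^ ?a q - 1"
      by (metis of_nat_power One_nat_def Suc_leI le_diff_eq of_nat_1 of_nat_add of_nat_le_iff plus_1_eq_Suc add.commute)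
    then show ?thesis using q \<open>0 < totient (q ^ ?a q)\<close> by (simp add: e_def)
  qed
  have four: "4 \<le> ?F p"
  proof -
    have p2: "2 \<le> real p" using prime_ge_2_nat[OF p] by simp
    have tot: "real (totient (p ^ Suc b)) = real p ^ b * (real p - 1)"
      using prime_ge_1_nat[OF p] by (simp only: totient_prime_power_Suc[OF p]) (simp add: of_nat_diff)
    have "1 \<le> real p ^ b" using p2 by simp
    \<comment> \<open>This is \<open>(p - 1) * (p - 2) \<ge> 0\<close> rewritten. Multiplied by
      \<open>p ^ b\<close>, the left factor becomes
      \<open>p ^ (b + 2) - 3 * p ^ b * (p - 1)\<close>, so the fraction in \<open>?F p\<close> is at
      least 3.\<close>
    moreover have "1 \<le> real p * (real p - 3) + 3"
      using mult_nonneg_nonneg[of "real p - 2" "real p - 1"] p2 by (simp add: algebra_simps)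
    ultimately have "1 * 1 \<le> real p ^ b * (real p * (real p - 3) + 3)"
      by (intro mult_mono) auto
    then have "3 * (real p ^ b * (real p - 1)) \<le> real p ^ Suc (Suc b) - 1"
      by (simp add: algebra_simps)
    moreover have "0 < real p ^ b * (real p - 1)" using p2 by simp
    ultimately show ?thesis
      unfolding b e_def by (simp add: tot le_divide_eq del: power_Suc)
  qed
  have "2 * 2 ^ card ?P = 4 * (\<Prod>q\<in>?P - {p}. (2::real))"
    using card.remove[OF _ pP] by simp
  also have "\<dots> \<le> ?F p * (\<Prod>q\<in>?P - {p}. ?F q)"
    using four two by (intro mult_mono prod_mono prod_nonneg) auto
  also have "\<dots> = (\<Prod>q\<in>?P. ?F q)"
    using pP by (simp add: prod.remove)
  also note le
  finally have "2 * 2 ^ card ?P \<le> real (cyc G)" .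
  moreover have "num_prime_divisors G = card ?P"
    using n by (simp add: num_prime_divisors_def prime_factors_dvd)
  ultimately show False
    using assms by (simp add: cyc_eta_def divide_less_eq)
qed

end

section \<open>Cyclic Sylow subgroups in subgroups and quotients\<close>

text \<open>Right multiplication on right cosets becomes a left action, as
  \<open>group_action\<close> demands, once the group element is inverted.\<close>

lemma (in group) coset_action:
  assumes "subgroup H G"
  shows "group_action G (rcosets H) (\<lambda>g. \<lambda>R\<in>rcosets H. R #> inv g)"
proof -
  let ?\<phi> = "\<lambda>g. \<lambda>R\<in>rcosets H. R #> inv g"
  have sub: "H \<subseteq> carrier G" using assms by (rule subgroup.subset)
  have closed: "R #> g \<in> rcosets H" if "R \<in> rcosets H" "g \<in> carrier G" for R g
    using that sub by (auto simp: RCOSETS_def coset_mult_assoc)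
  have assoc: "R #> g #> h = R #> (g \<otimes> h)" if "R \<in> rcosets H" "g \<in> carrier G" "h \<in> carrier G" for R g h
    using that rcosets_part_G[OF assms] by (intro coset_mult_assoc) auto
  have one: "R #> \<one> = R" if "R \<in> rcosets H" for R
    using that rcosets_part_G[OF assms] by (intro coset_mult_one) auto
  have Bij: "?\<phi> g \<in> Bij (rcosets H)" if g: "g \<in> carrier G" for g
  proof -
    have "bij_betw (?\<phi> g) (rcosets H) (rcosets H)"
      by (rule bij_betw_byWitness[where f' = "\<lambda>R. R #> g"]) (use g in \<open>auto simp: closed assoc one\<close>)
    then show ?thesis by (simp add: Bij_def)
  qed
  have "?\<phi> (g \<otimes> h) = compose (rcosets H) (?\<phi> g) (?\<phi> h)" if "g \<in> carrier G" "h \<in> carrier G" for g h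
    using that by (auto simp: compose_def fun_eq_iff closed assoc inv_mult_group)
  then have "?\<phi> \<in> hom G (BijGroup (rcosets H))"
    by (intro homI) (simp_all add: BijGroup_def Bij)
  then show ?thesis
    by (simp add: group_action_def group_hom_def group_hom_axioms_def group_BijGroup)
qed

context finite_group
begin

lemma ord_conj:
  assumes "g \<in> carrier G" "x \<in> carrier G"
  shows "ord (g \<otimes> x \<otimes> inv g) = ord x"
proof -
  have iff: "ord (g \<otimes> x \<otimes> inv g) dvd k \<longleftrightarrow> ord x dvd k" for k
  proof -
    have conj: "g \<otimes> x \<otimes> inv g \<in> carrier G" using assms by simp
    show ?thesis
      unfolding pow_eq_id[OF conj, symmetric] pow_eq_id[OF assms(2), symmetric]
      by (rule conj_pow_eq_one_iff[OF assms])
  qed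
  show ?thesis
    by (rule dvd_antisym[OF iff[THEN iffD2, OF dvd_refl] iff[THEN iffD1, OF dvd_refl]])
qed

text \<open>
  Some orbit of \<open>\<langle>x\<rangle>\<close> on the cosets of \<open>H\<close> has length at most the \<open>p\<close>-part of the index of \<open>H\<close>, so a
  conjugate of a small power of \<open>x\<close> lies in \<open>H\<close>.
\<close>

lemma cyclic_sylow_subgroup_element:
  assumes H: "subgroup H G" and p: "Factorial_Ring.prime p"
    and x: "x \<in> carrier G" "ord x = p ^ multiplicity p (order G)"
  obtains y where "y \<in> H" "p ^ multiplicity p (card H) dvd ord y"
proof -
  let ?a = "multiplicity p (order G)" and ?b = "multiplicity p (card H)"
  define c where "c = multiplicity p (card (rcosets H))"
  have n: "0 < order G" using order_gt_0_iff_finite by simp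
  have lag: "card (rcosets H) * card H = order G" by (rule lagrange[OF H])
  have "card (rcosets H) * card H \<noteq> 0" using lag n by simp
  then have nz: "card (rcosets H) \<noteq> 0" "card H \<noteq> 0" by auto
  have a: "?a = c + ?b"
    using p nz unfolding c_def lag[symmetric] by (intro prime_elem_multiplicity_mult_distrib) auto
  let ?X = "generate G {x}" and ?\<phi> = "\<lambda>g. \<lambda>R\<in>rcosets H. R #> inv g"
  have X: "subgroup ?X G" using generate_is_subgroup[of "{x}"] x by simp
  interpret act: group_action "G\<lparr>carrier := ?X\<rparr>" "rcosets H" ?\<phi>
    using group_action.induced_action[OF coset_action[OF H] X] .
  let ?orb = "orbit (G\<lparr>carrier := ?X\<rparr>) ?\<phi>"
  have orbX: "card (?orb R) dvd p ^ ?a" if "R \<in> rcosets H" for R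
    using act.orbit_stabilizer_theorem[OF that] generate_pow_card[OF x(1)] x(2)
    by (simp add: order_def) (metis dvd_triv_left)
  have fin: "finite (rcosets H)" using nz card_ge_0_finite by blast
  \<comment> \<open>Orbit lengths are powers of \<open>p\<close>. If all exceeded
    \<open>p ^ c\<close>, then \<open>p ^ Suc c\<close> would divide the number of cosets.\<close>
  have "\<exists>R\<in>rcosets H. card (?orb R) \<le> p ^ c"
  proof (rule ccontr)
    assume "\<not> ?thesis"
    then have no: "p ^ c < card (?orb R)" if "R \<in> rcosets H" for R
      using that by (meson not_le)
    have "p ^ Suc c dvd card (?orb R)" if R: "R \<in> rcosets H" for R
    proof -
      obtain i where i: "card (?orb R) = p ^ i"
        using orbX[OF R] divides_primepow_nat[OF p] by blast
      have "p ^ c < p ^ i" using no[OF R] i by simp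
      then have "c < i" using prime_gt_1_nat[OF p] power_less_imp_less_exp by blast
      then show ?thesis unfolding i by (intro le_imp_power_dvd) simp
    qed
    then have "p ^ Suc c dvd (\<Sum>Y\<in>orbits (G\<lparr>carrier := ?X\<rparr>) (rcosets H) ?\<phi>. card Y)"
      by (intro dvd_sum) (auto simp: orbits_def)
    also have "(\<Sum>Y\<in>orbits (G\<lparr>carrier := ?X\<rparr>) (rcosets H) ?\<phi>. card Y) = card (rcosets H)"
      using act.disjoint_sum[OF fin, of "\<lambda>_. 1::nat"] by simp
    finally show False
      using p nz unfolding c_def by (metis multiplicity_geI not_less_eq_eq order_refl not_prime_unit)
  qed
  then obtain R where R: "R \<in> rcosets H" "card (?orb R) \<le> p ^ c" by blast
  let ?t = "card (?orb R)"
  obtain g where g: "g \<in> carrier G" "R = H #> g" using R(1) by (auto simp: RCOSETS_def)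
  \<comment> \<open>The arguments \<open>0, ..., ?t\<close> give \<open>?t + 1\<close> translates in
    an orbit of size \<open>?t\<close>, so two of them agree, and \<open>R\<close> is fixed by
    \<open>x [^] (l - k)\<close>.\<close>
  let ?f = "\<lambda>k. R #> inv (x [^] (k::nat))"
  have "?f ` {0..?t} \<subseteq> ?orb R"
  proof
    fix S assume "S \<in> ?f ` {0..?t}"
    then obtain k where "S = ?f k" by blast
    moreover have "x [^] k \<in> ?X"
      using generate_pow_on_finite_carrier[OF finite_carrier x(1)] by blast
    ultimately show "S \<in> ?orb R"
      using R(1) by (auto simp: orbit_def)
  qed
  moreover have "?orb R \<subseteq> rcosets H"
    unfolding orbit_def using act.element_image[OF _ R(1) refl] by blast
  then have "finite (?orb R)" using fin finite_subset by blast
  ultimately have "card (?f ` {0..?t}) \<le> ?t" by (simp add: card_mono)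
  then have "\<not> inj_on ?f {0..?t}" by (intro pigeonhole) simp
  then obtain k l where kl: "k < l" "l \<le> ?t" "?f k = ?f l"
    unfolding inj_on_def by (metis atLeastAtMost_iff linorder_neqE_nat)
  let ?y = "g \<otimes> x [^] (l - k) \<otimes> inv g"
  have "H #> (g \<otimes> inv (x [^] k)) = H #> (g \<otimes> inv (x [^] l))"
    using kl(3) g x(1) subgroup.subset[OF H] by (simp add: coset_mult_assoc)
  then have "g \<otimes> inv (x [^] k) \<in> H #> (g \<otimes> inv (x [^] l))"
    using rcos_self[OF _ H, of "g \<otimes> inv (x [^] k)"] g x(1) by simp
  then have "(g \<otimes> inv (x [^] k)) \<otimes> inv (g \<otimes> inv (x [^] l)) \<in> H"
    using subgroup.rcos_module_imp[OF H is_group, of "g \<otimes> inv (x [^] l)"] g x(1) by simp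
  also have "(g \<otimes> inv (x [^] k)) \<otimes> inv (g \<otimes> inv (x [^] l)) = ?y"
  proof -
    have "x [^] l = x [^] k \<otimes> x [^] (l - k)" using kl(1) x(1) by (simp add: nat_pow_mult)
    then have "inv (x [^] k) \<otimes> x [^] l = x [^] (l - k)" using x(1) by (simp flip: m_assoc)
    then show ?thesis using g x(1) by (simp add: inv_mult_group m_assoc) (simp flip: m_assoc)
  qed
  finally have "?y \<in> H" .
  moreover have "p ^ ?b dvd ord ?y"
  proof -
    \<comment> \<open>The order of \<open>?y\<close> is \<open>p ^ ?a\<close> divided by this gcd,
      which is at most \<open>l - k \<le> p ^ c\<close>; moreover
      \<open>?a - c = ?b\<close>.\<close>
    let ?g = "gcd (p ^ ?a) (l - k)"
    obtain i where i: "i \<le> ?a" "?g = p ^ i"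
      using divides_primepow_nat[OF p, of ?g ?a] by auto
    have "?g \<le> l - k" using kl(1) by (intro gcd_le2_nat) simp
    then have "p ^ i \<le> p ^ c" using i(2) kl(2) R(2) by linarith
    then have "i \<le> c" using prime_gt_1_nat[OF p] power_le_imp_le_exp by blast
    have "ord ?y = p ^ ?a div p ^ i"
      using g x kl(1) i(2) by (simp add: ord_conj ord_pow_gen)
    also have "\<dots> = p ^ (?a - i)" using i(1) prime_gt_0_nat[OF p] by (simp add: power_diff)
    finally show ?thesis using a \<open>i \<le> c\<close> by (auto intro: le_imp_power_dvd)
  qed
  ultimately show thesis using that by blast
qed

lemma cyclic_sylow_iff:
  "cyclic_sylow G \<longleftrightarrow> (\<forall>p. Factorial_Ring.prime p \<longrightarrow> (\<exists>x\<in>carrier G. p ^ multiplicity p (order G) dvd ord x))"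
  unfolding cyclic_sylow_def by (metis dvd_refl ord_power_of_dvd)

lemma cyclic_sylow_subgroup:
  assumes "cyclic_sylow G" and H: "subgroup H G"
  shows "cyclic_sylow (G\<lparr>carrier := H\<rparr>)"
proof -
  interpret H: finite_group "G\<lparr>carrier := H\<rparr>"
    by (rule finite_group_subgroup[OF finite_group_axioms H])
  show ?thesis
    unfolding H.cyclic_sylow_iff
  proof (intro allI impI)
    fix p :: nat assume p: "Factorial_Ring.prime p"
    then obtain x where "x \<in> carrier G" "ord x = p ^ multiplicity p (order G)"
      using assms(1) by (auto simp: cyclic_sylow_def)
    then obtain y where "y \<in> H" "p ^ multiplicity p (card H) dvd ord y"
      using cyclic_sylow_subgroup_element[OF H p] by blast
    then show "\<exists>x\<in>carrier (G\<lparr>carrier := H\<rparr>).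
        p ^ multiplicity p (order (G\<lparr>carrier := H\<rparr>)) dvd H.ord x"
      by (auto simp: ord_subgroup[OF H] order_def)
  qed
qed

text \<open>The order of \<open>P\<close> is its own \<open>p\<close>-part, so an element of
  \<open>P\<close> whose order is divisible by that part generates \<open>P\<close>.\<close>

lemma cyclic_if_sylow_subgroup:
  assumes "cyclic_sylow G" "sylow_subgroup p P G"
  shows "cyclic_group (G\<lparr>carrier := P\<rparr>)"
proof -
  have P: "subgroup P G" "card P = p ^ multiplicity p (order G)" and p: "Factorial_Ring.prime p"
    using assms(2) by (auto simp: sylow_subgroup_def)
  obtain x where "x \<in> carrier G" "ord x = p ^ multiplicity p (order G)"
    using assms(1) p by (auto simp: cyclic_sylow_def)
  then obtain y where y: "y \<in> P" "p ^ multiplicity p (card P) dvd ord y"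
    using cyclic_sylow_subgroup_element[OF P(1) p] by blast
  then have "card P dvd ord y" using p P(2) by (simp add: prime_multiplicity_other)
  moreover have "ord y dvd card P"
    using group.ord_dvd_group_order[OF subgroup_imp_group[OF P(1)], of y] y(1)
    by (simp add: ord_subgroup[OF P(1)] order_def)
  ultimately have "ord y = card P" by (rule dvd_antisym[rotated])
  then show ?thesis
    using y(1) by (auto simp: cyclic_subgroup_iff_ord[OF P(1)])
qed

section \<open>Quotients and abelian groups\<close>

lemma finite_group_quotient:
  assumes "N \<lhd> G"
  shows "finite_group (G Mod N)"
proof -
  have "finite (rcosets N)"
    using lagrange[OF normal_imp_subgroup[OF assms]] order_gt_0_iff_finite finite_carrier
    by (metis card.infinite mult_0 not_gr_zero)
  then show ?thesis
    using normal.factorgroup_is_group[OF assms]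
    by (simp add: finite_group_def finite_group_axioms_def FactGroup_def)
qed

lemma order_quotient:
  assumes "N \<lhd> G"
  shows "order (G Mod N) * card N = order G"
  using lagrange[OF normal_imp_subgroup[OF assms]] by (simp add: order_def FactGroup_def)

text \<open>Let the coset of an element \<open>x\<close> of order \<open>p ^ ?a\<close> have order
  \<open>p ^ j\<close>. Then \<open>x ^ (p ^ j)\<close> lies in \<open>N\<close>, so
  \<open>p ^ ?a\<close> divides \<open>p ^ j * card N\<close>, and \<open>j\<close> is at least the
  exponent of \<open>p\<close> in the order of the quotient.\<close>

lemma cyclic_sylow_quotient:
  assumes "cyclic_sylow G" and N: "N \<lhd> G"
  shows "cyclic_sylow (G Mod N)"
proof -
  interpret Q: finite_group "G Mod N" by (rule finite_group_quotient[OF N])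
  interpret N: normal N G by (rule N)
  interpret h: group_hom G "G Mod N" "\<lambda>a. N #> a"
    using N.r_coset_hom_Mod by unfold_locales
  interpret S: finite_group "G\<lparr>carrier := N\<rparr>"
    by (rule finite_group_subgroup[OF finite_group_axioms N.subgroup_axioms])
  have n: "0 < order G" using order_gt_0_iff_finite by simp
  show ?thesis
    unfolding Q.cyclic_sylow_iff
  proof (intro allI impI)
    fix p :: nat assume p: "Factorial_Ring.prime p"
    let ?a = "multiplicity p (order G)"
    obtain x where x: "x \<in> carrier G" "ord x = p ^ ?a"
      using assms(1) p by (auto simp: cyclic_sylow_def)
    let ?X = "N #> x"
    have X: "?X \<in> carrier (G Mod N)" using x by simp
    have a: "?a = multiplicity p (order (G Mod N)) + multiplicity p (card N)"
      using p n order_quotient[OF N] by (metis mult_is_0 not_gr_zero prime_elem_multiplicity_mult_distrib prime_imp_prime_elem)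
    have pow: "?X [^]\<^bsub>G Mod N\<^esub> k = N #> x [^] k" for k :: nat
      using x(1) h.hom_nat_pow by simp
    have "?X [^]\<^bsub>G Mod N\<^esub> (p ^ ?a) = \<one>\<^bsub>G Mod N\<^esub>"
      using x by (metis h.hom_one pow pow_ord_eq_1)
    then have "Q.ord ?X dvd p ^ ?a" by (rule Q.pow_eq_id[OF X, THEN iffD1])
    then obtain j where j: "Q.ord ?X = p ^ j" using divides_primepow_nat[OF p] by blast
    have "N #> x [^] (p ^ j) = N"
      using Q.pow_ord_eq_1[OF X] by (simp only: j pow one_FactGroup)
    then have "x [^] (p ^ j) \<in> N"
      using rcos_self[OF _ N.subgroup_axioms, of "x [^] (p ^ j)"] x(1) by simp
    then have "(x [^] (p ^ j)) [^] card N = \<one>"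
      using S.pow_order_eq_1 by (simp add: order_def flip: nat_pow_consistent)
    then have "p ^ ?a dvd p ^ j * card N"
      using x by (simp add: nat_pow_pow pow_eq_id)
    moreover have "card N \<noteq> 0" using order_quotient[OF N] n by (metis mult_0_right not_gr_zero)
    ultimately have "?a \<le> j + multiplicity p (card N)"
      using p prime_gt_1_nat[OF p] multiplicity_geI[of "p ^ j * card N" p ?a]
      by (simp add: prime_elem_multiplicity_mult_distrib prime_elem_multiplicity_power_distrib)
    then have "p ^ multiplicity p (order (G Mod N)) dvd Q.ord ?X"
      unfolding j using a by (intro le_imp_power_dvd) simp
    then show "\<exists>x\<in>carrier (G Mod N). p ^ multiplicity p (order (G Mod N)) dvd Q.ord x"
      using X by blast
  qed
qed

text \<open>Raising \<open>x \<otimes> y\<close> to the power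
  \<open>ord (x \<otimes> y) * ord y\<close> eliminates \<open>y\<close>, so \<open>ord x\<close>
  divides that exponent and, by coprimality, \<open>ord (x \<otimes> y)\<close>; likewise for
  \<open>ord y\<close>.\<close>

lemma ord_mult_coprime:
  assumes xy: "x \<in> carrier G" "y \<in> carrier G" "x \<otimes> y = y \<otimes> x" and cop: "coprime (ord x) (ord y)"
  shows "ord (x \<otimes> y) = ord x * ord y"
proof (rule dvd_antisym)
  show "ord (x \<otimes> y) dvd ord x * ord y" by (rule ord_mul_divides[OF xy(3,1,2)])
  have pow: "x [^] (ord (x \<otimes> y) * k) \<otimes> y [^] (ord (x \<otimes> y) * k) = \<one>" for k
    using xy by (simp add: pow_eq_id flip: pow_mult_distrib)
  have "y [^] (ord (x \<otimes> y) * ord y) = \<one>" "x [^] (ord (x \<otimes> y) * ord x) = \<one>"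
    using xy by (simp_all add: pow_eq_id)
  then have "ord x dvd ord (x \<otimes> y) * ord y" "ord y dvd ord (x \<otimes> y) * ord x"
    using xy pow[of "ord y"] pow[of "ord x"] by (simp_all flip: pow_eq_id)
  then have "ord x dvd ord (x \<otimes> y)" "ord y dvd ord (x \<otimes> y)"
    using cop by (simp_all add: coprime_dvd_mult_left_iff coprime_commute)
  then show "ord x * ord y dvd ord (x \<otimes> y)"
    using cop by (simp add: divides_mult)
qed

text \<open>Multiplying elements of order the full \<open>p\<close>-part, one for each prime factor,
  gives an element whose order is the group order.\<close>

lemma cyclic_if_comm_cyclic_sylow:
  assumes "comm_group G" "cyclic_sylow G"
  shows "cyclic_group G"
proof -
  interpret comm_group G by fact
  let ?P = "prime_factors (order G)"
  have n: "0 < order G" using order_gt_0_iff_finite by simp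
  have "\<exists>x\<in>carrier G. ord x = (\<Prod>p\<in>S. p ^ multiplicity p (order G))" if "S \<subseteq> ?P" for S
  proof -
    have "finite S" using that finite_subset by auto
    then show ?thesis using that
    proof (induction S)
      case empty
      then show ?case by (intro bexI[of _ \<one>]) auto
    next
      case (insert p S)
      then obtain x where x: "x \<in> carrier G" "ord x = (\<Prod>p\<in>S. p ^ multiplicity p (order G))" by auto
      have p: "Factorial_Ring.prime p" using insert.prems by auto
      then obtain y where y: "y \<in> carrier G" "ord y = p ^ multiplicity p (order G)"
        using assms(2) by (auto simp: cyclic_sylow_def)
      have "coprime (ord y) (ord x)"
        unfolding x(2) y(2) using insert.prems insert.hyps p
        by (intro prod_coprime_right coprime_power_left_iff[THEN iffD2] disjI1
            coprime_power_right_iff[THEN iffD2] primes_coprime) auto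
      then have "ord (y \<otimes> x) = (\<Prod>p\<in>insert p S. p ^ multiplicity p (order G))"
        using ord_mult_coprime[of y x] x y insert.hyps m_comm by simp
      then show ?case using x y by blast
    qed
  qed
  from this[of ?P] obtain x where "x \<in> carrier G" "ord x = (\<Prod>p\<in>?P. p ^ multiplicity p (order G))" by auto
  then show ?thesis
    using n by (auto simp: cyclic_group_iff_ord prime_factorization_nat[symmetric])
qed

end

section \<open>The derived subgroup\<close>

context finite_group
begin

lemma dvd_class_roots:
  assumes y: "y \<in> carrier G" and mk: "order G = m * k" "coprime m k"
  shows "m dvd card (conj_class y) * roots_in_centralizer m y"
proof (rule dvd_class_roots_if_frobenius[OF y mk])
  fix b c assume bc: "card (centralizer G y) = b * c" "coprime b c"
  have C: "subgroup (centralizer G y) G" using y by (rule centralizer_subgroup)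
  show "b dvd card {x \<in> centralizer G y. x [^] b = \<one>}"
    using frobenius_coprime_factor[OF finite_group_subgroup[OF finite_group_axioms C], of b c] bc
    by (simp add: order_def flip: nat_pow_consistent)
qed

text \<open>Both elements have the same centralizer: commuting with a generator means commuting with
  the whole cyclic group.\<close>

lemma roots_in_centralizer_generate:
  assumes x: "x \<in> carrier G" and y: "y \<in> carrier G" and eq: "generate G {x} = generate G {y}"
  shows "roots_in_centralizer m x = roots_in_centralizer m y"
proof -
  have "centralizer G x \<subseteq> centralizer G y"
    if x: "x \<in> carrier G" and y: "y \<in> carrier G" and eq: "generate G {x} = generate G {y}" for x y
  proof
    fix g assume g: "g \<in> centralizer G x"
    then have gG: "g \<in> carrier G" by (simp add: centralizer_def)
    have "{x} \<subseteq> centralizer G g" using g x by (simp add: centralizer_def)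
    then have "generate G {x} \<subseteq> centralizer G g"
      by (rule generate_subgroup_incl[OF _ centralizer_subgroup[OF gG]])
    then have "y \<in> centralizer G g" using eq generate_singleton_self[of y] by blast
    then show "g \<in> centralizer G y" using gG by (simp add: centralizer_def)
  qed
  from this[OF x y eq] this[OF y x eq[symmetric]] have "centralizer G x = centralizer G y" by blast
  then show ?thesis by (simp add: roots_in_centralizer_def)
qed

text \<open>Elements of order \<open>d\<close> fall into sets of \<open>totient d\<close> generators
  of a common subgroup, and the summand is constant on each set.\<close>

lemma totient_dvd_sum_roots:
  "totient d dvd (\<Sum>y | y \<in> carrier G \<and> ord y = d. roots_in_centralizer m y)"
proof -
  let ?Y = "{y \<in> carrier G. ord y = d}" and ?gen = "\<lambda>x. generate G {x}"
  have "(\<Sum>y\<in>?Y. roots_in_centralizer m y)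
      = (\<Sum>C\<in>?gen ` ?Y. \<Sum>y | y \<in> ?Y \<and> ?gen y = C. roots_in_centralizer m y)"
    by (rule sum.image_gen) simp
  also have "totient d dvd \<dots>"
  proof (rule dvd_sum)
    fix C assume "C \<in> ?gen ` ?Y"
    then obtain x where x: "x \<in> carrier G" "ord x = d" "C = ?gen x" by blast
    have "{y \<in> ?Y. ?gen y = C} = {y \<in> carrier G. ?gen y = ?gen x}"
      using x by (auto simp: generate_pow_card)
    then have "(\<Sum>y | y \<in> ?Y \<and> ?gen y = C. roots_in_centralizer m y)
        = (\<Sum>y | y \<in> carrier G \<and> ?gen y = ?gen x. roots_in_centralizer m x)"
      using x(1) by (intro sum.cong) (auto intro: roots_in_centralizer_generate)
    also have "\<dots> = totient d * roots_in_centralizer m x"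
      using x by (simp add: card_generators)
    finally show "totient d dvd (\<Sum>y | y \<in> ?Y \<and> ?gen y = C. roots_in_centralizer m y)" by simp
  qed
  finally show ?thesis .
qed

lemma roots_in_centralizer_one:
  "roots_in_centralizer m \<one> = card {x \<in> carrier G. x [^] m = \<one>}"
  by (auto simp: roots_in_centralizer_def centralizer_def intro!: arg_cong[where f = card])

lemma roots_in_centralizer_pos:
  assumes "y \<in> carrier G"
  shows "0 < roots_in_centralizer m y"
proof -
  have "\<one> \<in> {z \<in> centralizer G y. z [^] m = \<one>}" using assms by (simp add: centralizer_def)
  moreover have "finite {z \<in> centralizer G y. z [^] m = \<one>}" by (auto simp: centralizer_def)
  ultimately show ?thesis unfolding roots_in_centralizer_def card_gt_0_iff by blast
qed

text \<open>Induction on \<open>k\<close>, absorbing the part \<open>p ^ a\<close> of its largest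
  prime into \<open>m\<close>. The \<open>m * p ^ a\<close> solutions for the larger exponent are
  sorted by the order \<open>p ^ j\<close> of their \<open>p\<close>-part. Each level
  \<open>j \<ge> 1\<close> has a positive size divisible by the coprime numbers \<open>m\<close> and
  \<open>totient (p ^ j)\<close>. Since these totients sum to \<open>p ^ a - 1\<close>, at most
  \<open>m\<close> solutions remain for \<open>j = 0\<close>, and their number is a positive
  multiple of \<open>m\<close>.\<close>

lemma card_roots_large_primes:
  assumes "cyclic_sylow G" "order G = m * k"
    and "\<And>p q. Factorial_Ring.prime p \<Longrightarrow> p dvd k \<Longrightarrow> Factorial_Ring.prime q \<Longrightarrow> q dvd m \<Longrightarrow> p < q"
  shows "card {x \<in> carrier G. x [^] m = \<one>} = m"
  using assms(2,3)
proof (induction k arbitrary: m rule: less_induct)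
  case (less k)
  have n: "0 < order G" using order_gt_0_iff_finite by simp
  then have k0: "0 < k" and m0: "0 < m" using less.prems(1) by auto
  have coprime_mk: "coprime m k"
    using less.prems(2) by (metis less_irrefl not_coprime_common_prime_nat)
  show ?case
  proof (cases "k = 1")
    case True
    then have "{x \<in> carrier G. x [^] m = \<one>} = carrier G"
      using less.prems(1) pow_order_eq_1 by auto
    then show ?thesis using less.prems True by (simp add: order_def)
  next
    case False
    \<comment> \<open>For the largest prime, the hypothesis passes to \<open>m * p ^ a\<close> and
      \<open>k'\<close>: the primes of \<open>k'\<close> are below \<open>p\<close>, and
      \<open>p\<close> is below those of \<open>m\<close>.\<close>
    define p where "p = Max (prime_factors k)"
    have "prime_factors k \<noteq> {}" using False k0 by (simp add: prime_factorization_empty_iff)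
    then have "p \<in> prime_factors k" unfolding p_def by (intro Max_in) auto
    then have p: "Factorial_Ring.prime p" "p dvd k" by auto
    have p_max: "r \<le> p" if "Factorial_Ring.prime r" "r dvd k" for r
      unfolding p_def using that k0 by (intro Max_ge) (auto simp: prime_factors_dvd)
    define a where "a = multiplicity p k"
    obtain k' where k': "k = p ^ a * k'" "\<not> p dvd k'"
      using multiplicity_decompose'[of k p] p k0 by (metis a_def neq0_conv not_prime_unit)
    have "0 < a" using p k0 by (simp add: a_def prime_multiplicity_gt_zero_iff)
    then have "1 < p ^ a" using one_less_power[OF prime_gt_1_nat[OF p(1)]] by blast
    then have "k' < k" using k0 k' by simp
    have nm: "\<not> p dvd m" using less.prems(2)[OF p p(1)] by blast
    have "coprime m (p ^ a)"
      using coprime_mk k'(1) by simp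
    have IH: "card {x \<in> carrier G. x [^] (m * p ^ a) = \<one>} = m * p ^ a"
    proof (rule less.IH[OF \<open>k' < k\<close>])
      show "order G = m * p ^ a * k'" using less.prems(1) k'(1) by simp
      fix r q assume r: "Factorial_Ring.prime r" "r dvd k'" and q: "Factorial_Ring.prime q" "q dvd m * p ^ a"
      have "r \<le> p" "r \<noteq> p" using p_max[OF r(1)] r(2) k' by auto
      then have "r < p" by simp
      moreover have "r < q" if "q dvd m" using less.prems(2)[of r q] r q(1) that k'(1) by simp
      moreover have "q = p" if "q dvd p ^ a"
        using that q(1) p(1) by (meson prime_dvd_power_nat primes_dvd_imp_eq)
      ultimately show "r < q" using q by (auto simp: prime_dvd_mult_iff)
    qed
    have "multiplicity p (order G) = a"
      using less.prems(1) p(1) nm k0 m0 by (simp add: prime_elem_multiplicity_mult_distrib a_def not_dvd_imp_multiplicity_0)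
    then obtain x where x: "x \<in> carrier G" "ord x = p ^ a"
      using assms(1) p(1) by (auto simp: cyclic_sylow_def)
    let ?Y = "\<lambda>j. {y \<in> carrier G. ord y = p ^ j}"
    let ?N = "\<lambda>j. \<Sum>y\<in>?Y j. roots_in_centralizer m y"
    have N_ge: "m * totient (p ^ j) \<le> ?N j" if j: "j \<in> {1..a}" for j
    proof -
      have "m dvd ?N j"
      proof (rule dvd_sum_class_function)
        show "m dvd card (conj_class y) * roots_in_centralizer m y" if "y \<in> ?Y j" for y
          using that dvd_class_roots less.prems(1) coprime_mk by blast
      qed (auto simp: ord_conj roots_in_centralizer_conj)
      moreover have "totient (p ^ j) dvd ?N j" by (rule totient_dvd_sum_roots)
      \<comment> \<open>Prime factors of this totient are at most \<open>p\<close>, whereas those of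
        \<open>m\<close> exceed \<open>p\<close>.\<close>
      moreover have "coprime m (totient (p ^ j))"
      proof (rule ccontr)
        assume "\<not> coprime m (totient (p ^ j))"
        then obtain r where r: "Factorial_Ring.prime r" "r dvd m" "r dvd totient (p ^ j)"
          by (rule not_coprime_common_prime_nat)
        have "p < r" using less.prems(2)[OF p r(1,2)] .
        have "r dvd p ^ (j - 1) * (p - 1)" using r(3) j p(1) by (simp add: totient_prime_power)
        then have "r dvd p \<or> r dvd p - 1" using r(1) by (metis prime_dvd_mult_iff prime_dvd_power)
        then have "r \<le> p" using prime_gt_1_nat[OF p(1)] by (auto dest!: dvd_imp_le)
        then show False using \<open>p < r\<close> by simp
      qed
      ultimately have "m * totient (p ^ j) dvd ?N j" by (simp add: divides_mult)
      \<comment> \<open>Divisibility bounds only a nonzero sum from below; a power of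
        \<open>x\<close> serves as an element of order \<open>p ^ j\<close>.\<close>
      moreover have "0 < ?N j"
      proof -
        have "p ^ j dvd ord x" using x(2) j by (simp add: le_imp_power_dvd)
        then obtain y where "y \<in> ?Y j" using ord_power_of_dvd[OF x(1)] by blast
        then show ?thesis using roots_in_centralizer_pos by (intro sum_pos) auto
      qed
      ultimately show ?thesis by (rule dvd_imp_le)
    qed
    have tot: "(\<Sum>j\<in>{1..a}. totient (p ^ j)) + 1 = p ^ a" for a
    proof (induction a)
      case (Suc a)
      have "p ^ a * (p - 1) + p ^ a = p ^ Suc a"
        using prime_gt_1_nat[OF p(1)] by (cases p) (auto simp: algebra_simps)
      then show ?case using Suc totient_prime_power_Suc[OF p(1), of a] by simp
    qed simp
    have "m * p ^ a = (\<Sum>y | y \<in> carrier G \<and> y [^] (p ^ a) = \<one>. roots_in_centralizer m y)"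
      using IH card_roots_coprime_mult[OF \<open>coprime m (p ^ a)\<close>] by simp
    also have "{y. y \<in> carrier G \<and> y [^] (p ^ a) = \<one>} = (\<Union>j\<in>{0..a}. ?Y j)"
    proof -
      have "ord y dvd p ^ a \<longleftrightarrow> (\<exists>j\<in>{0..a}. ord y = p ^ j)" for y
        unfolding divides_primepow_nat[OF p(1)] by auto
      then show ?thesis by (auto simp: pow_eq_id le_imp_power_dvd)
    qed
    also have "(\<Sum>y\<in>(\<Union>j\<in>{0..a}. ?Y j). roots_in_centralizer m y) = (\<Sum>j\<in>{0..a}. ?N j)"
      using prime_gt_1_nat[OF p(1)] by (intro sum.UNION_disjoint) auto
    also have "\<dots> = ?N 0 + (\<Sum>j\<in>{1..a}. ?N j)"
      by (simp add: sum.atLeast_Suc_atMost)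
    \<comment> \<open>Level 0 is the identity alone, whose centralizer is the whole group, so its
      term is the count in question.\<close>
    also have "?Y 0 = {\<one>}" using ord_eq_1 by auto
    also have "(\<Sum>y\<in>{\<one>}. roots_in_centralizer m y) = card {x \<in> carrier G. x [^] m = \<one>}"
      by (simp add: roots_in_centralizer_one)
    finally have "m * p ^ a = card {x \<in> carrier G. x [^] m = \<one>} + (\<Sum>j\<in>{1..a}. ?N j)" .
    moreover have "m * (\<Sum>j\<in>{1..a}. totient (p ^ j)) \<le> (\<Sum>j\<in>{1..a}. ?N j)"
      unfolding sum_distrib_left by (rule sum_mono) (rule N_ge)
    moreover have "m * p ^ a = m * (\<Sum>j\<in>{1..a}. totient (p ^ j)) + m"
      unfolding tot[of a, symmetric] by (simp add: algebra_simps)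
    ultimately have "card {x \<in> carrier G. x [^] m = \<one>} \<le> m" by linarith
    moreover have "m dvd card {x \<in> carrier G. x [^] m = \<one>}"
      by (rule frobenius_coprime_factor[OF finite_group_axioms less.prems(1) coprime_mk])
    moreover have "0 < card {x \<in> carrier G. x [^] m = \<one>}"
      using roots_in_centralizer_pos[of \<one> m] by (simp add: roots_in_centralizer_one)
    ultimately show ?thesis by (meson dvd_imp_le le_antisym)
  qed
qed

text \<open>Conjugation preserves \<open>x ^ m = 1\<close>, so only the subgroup property is at
  stake. By induction, the roots for \<open>m'\<close> form a normal subgroup of order
  \<open>m'\<close>; its product with a cyclic group of order \<open>p ^ a\<close> is a subgroup of
  order \<open>m\<close> and thus contains all \<open>m\<close> roots.\<close>

lemma roots_large_primes_normal:
  assumes "cyclic_sylow G" "order G = m * k"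
    and "\<And>p q. Factorial_Ring.prime p \<Longrightarrow> p dvd k \<Longrightarrow> Factorial_Ring.prime q \<Longrightarrow> q dvd m \<Longrightarrow> p < q"
  shows "{x \<in> carrier G. x [^] m = \<one>} \<lhd> G"
  using assms(2,3)
proof (induction m arbitrary: k rule: less_induct)
  case (less m)
  let ?R = "\<lambda>m. {x \<in> carrier G. x [^] (m::nat) = \<one>}"
  have n: "0 < order G" using order_gt_0_iff_finite by simp
  then have k0: "0 < k" and m0: "0 < m" using less.prems(1) by auto
  have coprime_mk: "coprime m k"
    using less.prems(2) by (metis less_irrefl not_coprime_common_prime_nat)
  have "subgroup (?R m) G"
  proof (cases "m = 1")
    case True
    then have "?R m = {\<one>}" by auto
    then show ?thesis using triv_subgroup by simp
  next
    case False
    \<comment> \<open>Removing the smallest prime of \<open>m\<close> keeps the primes of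
      \<open>m'\<close> above those of the new cofactor \<open>p ^ a * k\<close>.\<close>
    define p where "p = Min (prime_factors m)"
    have "prime_factors m \<noteq> {}" using False m0 by (simp add: prime_factorization_empty_iff)
    then have "p \<in> prime_factors m" unfolding p_def by (intro Min_in) auto
    then have p: "Factorial_Ring.prime p" "p dvd m" by auto
    have p_min: "p \<le> r" if "Factorial_Ring.prime r" "r dvd m" for r
      unfolding p_def using that m0 by (intro Min_le) (auto simp: prime_factors_dvd)
    define a where "a = multiplicity p m"
    obtain m' where m': "m = p ^ a * m'" "\<not> p dvd m'"
      using multiplicity_decompose'[of m p] p m0 by (metis a_def neq0_conv not_prime_unit)
    have "0 < a" using p m0 by (simp add: a_def prime_multiplicity_gt_zero_iff)
    then have "1 < p ^ a" using one_less_power[OF prime_gt_1_nat[OF p(1)]] by blast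
    then have "m' < m" using m0 m' by simp
    have "\<not> p dvd k" using less.prems(2)[OF p(1) _ p] by blast
    have cop: "coprime m' (p ^ a)" using prime_imp_coprime[OF p(1) m'(2)] by (simp add: coprime_commute)
    have ord': "order G = m' * (p ^ a * k)" using less.prems(1) m'(1) by simp
    have large: "r < q"
      if r: "Factorial_Ring.prime r" "r dvd p ^ a * k" and q: "Factorial_Ring.prime q" "q dvd m'" for r q
    proof -
      have "p \<le> q" "q \<noteq> p" using p_min[OF q(1)] q(2) m' by auto
      moreover have "r < q" if "r dvd k" using less.prems(2)[of r q] that r(1) q m'(1) by simp
      moreover have "r = p" if "r dvd p ^ a"
        using that r(1) p(1) by (meson prime_dvd_power_nat primes_dvd_imp_eq)
      ultimately show ?thesis using r by (auto simp: prime_dvd_mult_iff)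
    qed
    have N: "?R m' \<lhd> G" by (rule less.IH[OF \<open>m' < m\<close> ord']) (use large in blast)
    have cardN: "card (?R m') = m'"
      by (rule card_roots_large_primes[OF assms(1) ord']) (use large in blast)
    have "multiplicity p (order G) = a"
      using less.prems(1) p(1) \<open>\<not> p dvd k\<close> k0 m0
      by (simp add: prime_elem_multiplicity_mult_distrib a_def not_dvd_imp_multiplicity_0)
    then obtain x where x: "x \<in> carrier G" "ord x = p ^ a"
      using assms(1) p(1) by (auto simp: cyclic_sylow_def)
    let ?X = "generate G {x}"
    have X: "subgroup ?X G" using generate_is_subgroup[of "{x}"] x by simp
    define H where "H = ?R m' <#> ?X"
    have H: "subgroup H G"
      unfolding H_def using N X by (rule mult_norm_subgroup)
    have "card H \<le> card (?R m') * card ?X"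
    proof -
      have "H = (\<lambda>(a, b). a \<otimes> b) ` (?R m' \<times> ?X)" by (auto simp: H_def set_mult_def)
      moreover have "finite ?X" by (rule finite_subset[OF generate_singleton_closed[OF x(1)] finite_carrier])
      ultimately show ?thesis
        using card_image_le[of "?R m' \<times> ?X" "\<lambda>(a, b). a \<otimes> b"] by (simp add: card_cartesian_product)
    qed
    then have "card H \<le> m" using cardN generate_pow_card[OF x(1)] x(2) m'(1) by (simp add: mult.commute)
    \<comment> \<open>\<open>H\<close> contains subgroups of the coprime orders \<open>m'\<close>
      and \<open>p ^ a\<close>, which makes the upper bound on \<open>card H\<close> sharp.\<close>
    moreover have "m dvd card H"
    proof -
      have sub: "card K dvd card H" if "subgroup K G" "K \<subseteq> H" for K
        using group.lagrange[OF subgroup_imp_group[OF H] subgroup_incl[OF that(1) H that(2)]]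
        by (simp add: order_def) (metis dvd_triv_right)
      have "?R m' \<subseteq> H"
      proof
        fix u assume "u \<in> ?R m'"
        then show "u \<in> H" using subgroup.one_closed[OF X] unfolding H_def set_mult_def
          by (auto intro!: bexI[of _ u] bexI[of _ \<one>])
      qed
      moreover have "?X \<subseteq> H"
      proof
        fix u assume u: "u \<in> ?X"
        then have "u \<in> carrier G" by (rule subgroup.mem_carrier[OF X])
        then show "u \<in> H" using u unfolding H_def set_mult_def
          by (auto intro!: exI[of _ \<one>] bexI[of _ u])
      qed
      ultimately have "m' dvd card H" "p ^ a dvd card H"
        using sub[OF normal_imp_subgroup[OF N]] sub[OF X] cardN generate_pow_card[OF x(1)] x(2) by auto
      then show ?thesis using cop m'(1) by (simp add: divides_mult mult.commute)
    qed
    moreover have "0 < card H"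
      using subgroup.one_closed[OF H] finite_subset[OF subgroup.subset[OF H] finite_carrier]
      by (auto simp: card_gt_0_iff)
    ultimately have cardH: "card H = m" by (meson dvd_imp_le le_antisym)
    have "H \<subseteq> ?R m"
      using group.pow_order_eq_1[OF subgroup_imp_group[OF H]] subgroup.mem_carrier[OF H] cardH
      by (auto simp: order_def simp flip: nat_pow_consistent)
    moreover have "card (?R m) = m"
      by (rule card_roots_large_primes[OF assms(1) less.prems(1)]) (use less.prems(2) in blast)
    ultimately have "H = ?R m" using cardH by (intro card_subset_eq) auto
    then show ?thesis using H by simp
  qed
  then show ?case by (rule normal_invI) (auto simp: conj_pow_eq_one_iff)
qed

text \<open>For the smallest prime \<open>p\<close>, the roots belonging to the
  \<open>p\<close>-free part of the order form a proper normal subgroup. Its quotient has order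
  \<open>p ^ a\<close> and inherits cyclic Sylow subgroups, so it is cyclic, and the derived
  subgroup lies in that proper subgroup.\<close>

lemma derived_neq_carrier_if_cyclic_sylow:
  assumes "cyclic_sylow G" "order G \<noteq> 1"
  shows "derived G (carrier G) \<noteq> carrier G"
proof -
  have n: "0 < order G" using order_gt_0_iff_finite by simp
  define p where "p = Min (prime_factors (order G))"
  have "prime_factors (order G) \<noteq> {}" using assms(2) n by (simp add: prime_factorization_empty_iff)
  then have "p \<in> prime_factors (order G)" unfolding p_def by (intro Min_in) auto
  then have p: "Factorial_Ring.prime p" "p dvd order G" by auto
  have p_min: "p \<le> r" if "Factorial_Ring.prime r" "r dvd order G" for r
    unfolding p_def using that n by (intro Min_le) (auto simp: prime_factors_dvd)
  define a where "a = multiplicity p (order G)"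
  obtain m where m: "order G = p ^ a * m" "\<not> p dvd m"
    using multiplicity_decompose'[of "order G" p] p n by (metis a_def neq0_conv not_prime_unit)
  have "0 < a" using p n by (simp add: a_def prime_multiplicity_gt_zero_iff)
  then have pa: "1 < p ^ a" using one_less_power[OF prime_gt_1_nat[OF p(1)]] by blast
  have m0: "0 < m" using m(1) n by (cases m) auto
  have ord: "order G = m * p ^ a" using m(1) by simp
  have large: "r < q"
    if r: "Factorial_Ring.prime r" "r dvd p ^ a" and q: "Factorial_Ring.prime q" "q dvd m" for r q
  proof -
    have "p \<le> q" "q \<noteq> p" using p_min[OF q(1)] q(2) m by auto
    moreover have "r = p" using r p(1) by (meson prime_dvd_power_nat primes_dvd_imp_eq)
    ultimately show ?thesis by simp
  qed
  let ?K = "{x \<in> carrier G. x [^] m = \<one>}"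
  have K: "?K \<lhd> G" by (rule roots_large_primes_normal[OF assms(1) ord]) (use large in blast)
  have cardK: "card ?K = m" by (rule card_roots_large_primes[OF assms(1) ord]) (use large in blast)
  interpret Q: finite_group "G Mod ?K" by (rule finite_group_quotient[OF K])
  have ordQ: "order (G Mod ?K) = p ^ a"
    using order_quotient[OF K] ord m0 by (simp add: cardK)
  then have "multiplicity p (order (G Mod ?K)) = a"
    using p(1) prime_gt_1_nat[OF p(1)] by simp
  then have "\<exists>c\<in>carrier (G Mod ?K). Q.ord c = p ^ a"
    using cyclic_sylow_quotient[OF assms(1) K, unfolded cyclic_sylow_def, rule_format, OF p(1)]
    by (simp only:)
  then have "cyclic_group (G Mod ?K)"
    unfolding Q.cyclic_group_iff_ord ordQ .
  then have "derived G (carrier G) \<subseteq> ?K"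
    by (intro derived_minimal[OF K] Q.cyclic_imp_abelian_group)
  moreover have "?K \<noteq> carrier G"
  proof
    assume "?K = carrier G"
    then have "m = m * p ^ a" using cardK ord by (simp add: order_def)
    then show False using m0 pa by simp
  qed
  ultimately show ?thesis by blast
qed

text \<open>
  The automorphism group of a cyclic group is abelian, so conjugation by a commutator is trivial on \<open>E\<close>.
\<close>

lemma derived_centralizes_cyclic_normal:
  assumes E: "E \<lhd> G" and cyc: "cyclic_group (G\<lparr>carrier := E\<rparr>)"
    and u: "u \<in> derived G (carrier G)" and v: "v \<in> E"
  shows "u \<otimes> v = v \<otimes> u"
proof -
  have Esub: "subgroup E G" by (rule normal_imp_subgroup[OF E])
  obtain e where e: "e \<in> E" "ord e = card E"
    using cyc by (auto simp: cyclic_subgroup_iff_ord[OF Esub])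
  have eG: "e \<in> carrier G" by (rule subgroup.mem_carrier[OF Esub e(1)])
  have "generate G {e} = E"
    using e generate_pow_card[OF eG] generate_subgroup_incl[of "{e}" E] Esub
      finite_subset[OF subgroup.subset[OF Esub] finite_carrier]
    by (intro card_subset_eq) auto
  then have powers: "\<exists>k::nat. w = e [^] k" if "w \<in> E" for w
    using that generate_pow_on_finite_carrier[OF finite_carrier eG] by auto
  have "derived G (carrier G) \<subseteq> centralizer G e"
    unfolding derived_def
  proof (rule generate_subgroup_incl[OF _ centralizer_subgroup[OF eG]], clarify)
    fix g h assume gh: "g \<in> carrier G" "h \<in> carrier G"
    have conj: "\<exists>i::nat. a \<otimes> e \<otimes> inv a = e [^] i" if "a \<in> carrier G" for a
      using powers normal.inv_op_closed2[OF E that e(1)] by blast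
    \<comment> \<open>Conjugation by \<open>a\<close> and by \<open>b\<close> raises
      \<open>e\<close> to the powers \<open>i\<close> and \<open>j\<close>; composed in either order
      they give \<open>e [^] (i * j)\<close>.\<close>
    have comm: "(a \<otimes> b) \<otimes> e \<otimes> inv (a \<otimes> b) = (b \<otimes> a) \<otimes> e \<otimes> inv (b \<otimes> a)"
      if ab: "a \<in> carrier G" "b \<in> carrier G" for a b
    proof -
      obtain i j :: nat where i: "a \<otimes> e \<otimes> inv a = e [^] i" and j: "b \<otimes> e \<otimes> inv b = e [^] j"
        using conj ab by meson
      have "(a \<otimes> b) \<otimes> e \<otimes> inv (a \<otimes> b) = a \<otimes> (b \<otimes> e \<otimes> inv b) \<otimes> inv a"
           "(b \<otimes> a) \<otimes> e \<otimes> inv (b \<otimes> a) = b \<otimes> (a \<otimes> e \<otimes> inv a) \<otimes> inv b"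
        using ab eG by (simp_all add: inv_mult_group m_assoc)
      then show ?thesis
        using conj_pow[OF ab(1) eG, of j] conj_pow[OF ab(2) eG, of i] eG
        by (simp add: i j nat_pow_pow mult.commute)
    qed
    \<comment> \<open>The commutator of \<open>g\<close> and \<open>h\<close> is
      \<open>inv ?w \<otimes> ?v\<close>, where \<open>?v\<close> and \<open>?w\<close> multiply the
      same two elements in opposite order and so act alike on \<open>e\<close>.\<close>
    let ?v = "inv g \<otimes> inv h" and ?w = "inv h \<otimes> inv g"
    define c where "c = inv ?w \<otimes> ?v"
    have c: "g \<otimes> h \<otimes> inv g \<otimes> inv h = c" "c \<in> carrier G"
      using gh by (simp_all add: c_def inv_mult_group m_assoc)
    have "c \<otimes> e \<otimes> inv c = inv ?w \<otimes> (?v \<otimes> e \<otimes> inv ?v) \<otimes> ?w"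
      using gh eG by (simp add: c_def inv_mult_group m_assoc)
    also have "\<dots> = inv ?w \<otimes> (?w \<otimes> e \<otimes> inv ?w) \<otimes> ?w"
      using comm[of "inv g" "inv h"] gh by simp
    also have "\<dots> = e" using gh eG by (intro inv_conj(1)) auto
    finally have "c \<otimes> e = e \<otimes> c"
      using c(2) eG by (metis inv_solve_right' m_closed)
    then show "g \<otimes> h \<otimes> inv g \<otimes> inv h \<in> centralizer G e"
      using c by (simp add: centralizer_def)
  qed
  then have "e \<in> centralizer G u"
    using u eG by (auto simp: centralizer_def)
  moreover have "u \<in> carrier G" using u derived_in_carrier by blast
  ultimately have "generate G {e} \<subseteq> centralizer G u"
    using generate_subgroup_incl[OF _ centralizer_subgroup, of "{e}" u] by simp
  then show ?thesis using v \<open>generate G {e} = E\<close> by (auto simp: centralizer_def)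
qed

end

text \<open>The induction descends to the derived subgroup, which is smaller than a nontrivial
  \<open>G\<close> and again has cyclic Sylow subgroups.\<close>

theorem cyclic_derived_if_cyclic_sylow:
  assumes "finite_group G" "cyclic_sylow G"
  shows "cyclic_group (G\<lparr>carrier := derived G (carrier G)\<rparr>)"
  using assms
proof (induction "order G" arbitrary: G rule: less_induct)
  case less
  interpret finite_group G by fact
  let ?D = "derived G (carrier G)"
  let ?E = "derived G ?D"
  have D: "subgroup ?D G" by (rule derived_is_subgroup) simp
  have D_sub: "?D \<subseteq> carrier G" by (rule subgroup.subset[OF D])
  interpret D: finite_group "G\<lparr>carrier := ?D\<rparr>"
    by (rule finite_group_subgroup[OF finite_group_axioms D])
  have D_cyc: "cyclic_sylow (G\<lparr>carrier := ?D\<rparr>)" by (rule cyclic_sylow_subgroup[OF less.prems(2) D])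
  show ?case
  proof (cases "order G = 1")
    case True
    then have "carrier G = {\<one>\<^bsub>G\<^esub>}" using order_one_triv_iff by simp
    then have "?D = {\<one>\<^bsub>G\<^esub>}" using D_sub subgroup.one_closed[OF D] by auto
    then have "\<exists>x\<in>?D. group.ord G x = card ?D" by simp
    then show ?thesis by (simp only: cyclic_subgroup_iff_ord[OF D])
  next
    case False
    then have "?D \<subset> carrier G"
      using derived_neq_carrier_if_cyclic_sylow[OF less.prems(2)] D_sub by blast
    then have "order (G\<lparr>carrier := ?D\<rparr>) < order G" by (simp add: order_def psubset_card_mono)
    then have "cyclic_group (G\<lparr>carrier := ?D, carrier := derived (G\<lparr>carrier := ?D\<rparr>) ?D\<rparr>)"
      using less.hyps[OF _ D.finite_group_axioms D_cyc] by simp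
    then have E_cyc: "cyclic_group (G\<lparr>carrier := ?E\<rparr>)"
      by (simp add: derived_consistent[OF order_refl D])
    \<comment> \<open>With normality in \<open>G\<close>, and not only in \<open>?D\<close>, all of
      \<open>G\<close> acts on \<open>?E\<close> by conjugation; commutators of \<open>G\<close>
      then centralize \<open>?E\<close>, which makes \<open>?E\<close> central in
      \<open>?D\<close>.\<close>
    have E: "?E \<lhd> G" by (intro derived_is_normal derived_self_is_normal)
    have ED: "?E \<lhd> G\<lparr>carrier := ?D\<rparr>" by (rule derived_subgroup_is_normal[OF D])
    interpret Q: finite_group "G\<lparr>carrier := ?D\<rparr> Mod ?E" by (rule D.finite_group_quotient[OF ED])
    interpret h: group_hom "G\<lparr>carrier := ?D\<rparr>" "G\<lparr>carrier := ?D\<rparr> Mod ?E" "\<lambda>a. ?E #>\<^bsub>G\<lparr>carrier := ?D\<rparr>\<^esub> a"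
      using normal.r_coset_hom_Mod[OF ED] by unfold_locales
    have "cyclic_group (G\<lparr>carrier := ?D\<rparr> Mod ?E)"
      by (rule Q.cyclic_if_comm_cyclic_sylow[OF derived_quot_of_subgroup_is_comm_group[OF D] D.cyclic_sylow_quotient[OF D_cyc ED]])
    then obtain c where c: "c \<in> carrier (G\<lparr>carrier := ?D\<rparr> Mod ?E)"
      "carrier (G\<lparr>carrier := ?D\<rparr> Mod ?E) = range (\<lambda>n::int. c [^]\<^bsub>G\<lparr>carrier := ?D\<rparr> Mod ?E\<^esub> n)"
      using Q.cyclic_group by blast
    then obtain d where d: "d \<in> ?D" "c = ?E #>\<^bsub>G\<lparr>carrier := ?D\<rparr>\<^esub> d"
      by (auto simp: FactGroup_def RCOSETS_def)
    have dG: "d \<in> carrier G" using d D_sub by blast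
    \<comment> \<open>The coset of \<open>d\<close> generates the quotient, so \<open>?D\<close>
      consists of products of an element of the central subgroup \<open>?E\<close> and a power of
      \<open>d\<close>; such products commute.\<close>
    have decomp: "\<exists>v\<in>?E. \<exists>n::int. w = v \<otimes>\<^bsub>G\<^esub> d [^]\<^bsub>G\<^esub> n" if w: "w \<in> ?D" for w
    proof -
      have "?E #>\<^bsub>G\<lparr>carrier := ?D\<rparr>\<^esub> w \<in> carrier (G\<lparr>carrier := ?D\<rparr> Mod ?E)"
        using h.hom_closed[of w] w by simp
      then obtain n :: int where n: "?E #>\<^bsub>G\<lparr>carrier := ?D\<rparr>\<^esub> w = c [^]\<^bsub>G\<lparr>carrier := ?D\<rparr> Mod ?E\<^esub> n"
        unfolding c(2) by blast
      also have "\<dots> = ?E #>\<^bsub>G\<lparr>carrier := ?D\<rparr>\<^esub> (d [^]\<^bsub>G\<lparr>carrier := ?D\<rparr>\<^esub> n)"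
        using h.hom_int_pow[of d n] d by simp
      finally have "w \<in> ?E #>\<^bsub>G\<lparr>carrier := ?D\<rparr>\<^esub> (d [^]\<^bsub>G\<^esub> n)"
        using D.rcos_self[of w ?E] w normal_imp_subgroup[OF ED]
        by (simp add: int_pow_consistent[OF D d(1)])
      then show ?thesis by (auto simp: r_coset_def)
    qed
    have "comm_group (G\<lparr>carrier := ?D\<rparr>)"
    proof (rule D.group_comm_groupI)
      fix u v assume uv: "u \<in> carrier (G\<lparr>carrier := ?D\<rparr>)" "v \<in> carrier (G\<lparr>carrier := ?D\<rparr>)"
      then obtain s t and k l :: int where st: "s \<in> ?E" "t \<in> ?E"
        "u = s \<otimes>\<^bsub>G\<^esub> d [^]\<^bsub>G\<^esub> k" "v = t \<otimes>\<^bsub>G\<^esub> d [^]\<^bsub>G\<^esub> l"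
        using decomp[of u] decomp[of v] by auto
      have EG: "?E \<subseteq> carrier G" using subgroup.subset[OF normal_imp_subgroup[OF E]] .
      have G: "s \<in> carrier G" "t \<in> carrier G" "u \<in> carrier G" "d [^]\<^bsub>G\<^esub> l \<in> carrier G" "d [^]\<^bsub>G\<^esub> k \<in> carrier G"
        using st EG uv D_sub dG by auto
      have E_comm: "w \<otimes>\<^bsub>G\<^esub> z = z \<otimes>\<^bsub>G\<^esub> w" if "w \<in> ?D" "z \<in> ?E" for w z
        using derived_centralizes_cyclic_normal[OF E E_cyc] that by blast
      have ED': "?E \<subseteq> ?D" using subgroup.subset[OF normal_imp_subgroup[OF ED]] by simp
      have "d [^]\<^bsub>G\<^esub> k \<otimes>\<^bsub>G\<^esub> d [^]\<^bsub>G\<^esub> l = d [^]\<^bsub>G\<^esub> l \<otimes>\<^bsub>G\<^esub> d [^]\<^bsub>G\<^esub> k"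
        using dG by (simp add: int_pow_mult[symmetric] add.commute)
      moreover have "s \<otimes>\<^bsub>G\<^esub> d [^]\<^bsub>G\<^esub> l = d [^]\<^bsub>G\<^esub> l \<otimes>\<^bsub>G\<^esub> s"
        using E_comm[of "d [^]\<^bsub>G\<^esub> l" s] st(1) d(1) subgroup_int_pow_closed[OF D] by simp
      ultimately have "u \<otimes>\<^bsub>G\<^esub> d [^]\<^bsub>G\<^esub> l = d [^]\<^bsub>G\<^esub> l \<otimes>\<^bsub>G\<^esub> u"
        using G unfolding st(3) by (metis m_assoc)
      moreover have "u \<otimes>\<^bsub>G\<^esub> t = t \<otimes>\<^bsub>G\<^esub> u" using E_comm uv(1) st(2) by simp
      ultimately have "u \<otimes>\<^bsub>G\<^esub> v = v \<otimes>\<^bsub>G\<^esub> u"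
        using G unfolding st(4) by (metis m_assoc)
      then show "u \<otimes>\<^bsub>G\<lparr>carrier := ?D\<rparr>\<^esub> v = v \<otimes>\<^bsub>G\<lparr>carrier := ?D\<rparr>\<^esub> u" by simp
    qed
    then show ?thesis using D.cyclic_if_comm_cyclic_sylow D_cyc by blast
  qed
qed

theorem theorem4p2:
  fixes G :: "('a, 'b) monoid_scheme"
  assumes "group G"
    and "finite (carrier G)"
    and "cyc_eta G < 2"
  shows "(\<forall>p P. sylow_subgroup p P G \<longrightarrow> cyclic_group (G\<lparr>carrier := P\<rparr>)) \<and> metacyclic_group G"
proof -
  interpret finite_group G
    using assms by (simp add: finite_group_def finite_group_axioms_def)
  have Z: "cyclic_sylow G" using assms(3) by (rule cyclic_sylow_if_cyc_eta)
  \<comment> \<open>The derived subgroup is the witness for metacyclicity; its quotient is abelian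
    with cyclic Sylow subgroups, hence cyclic.\<close>
  let ?D = "derived G (carrier G)"
  have D: "?D \<lhd> G" by (rule derived_self_is_normal)
  interpret Q: finite_group "G Mod ?D" by (rule finite_group_quotient[OF D])
  have "cyclic_group (G Mod ?D)"
    by (rule Q.cyclic_if_comm_cyclic_sylow[OF derived_quot_is_comm_group cyclic_sylow_quotient[OF Z D]])
  moreover have "cyclic_group (G\<lparr>carrier := ?D\<rparr>)"
    by (rule cyclic_derived_if_cyclic_sylow[OF finite_group_axioms Z])
  ultimately have "metacyclic_group G" using D unfolding metacyclic_group_def by blast
  then show ?thesis using cyclic_if_sylow_subgroup[OF Z] by blast
qed

end
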